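(* Let $G$ be a block graph of order $n$. Then $\iota(G)=\frac{n}{3}$ if and only if $G\in\mathcal{B}$.
   Context: Graphs are finite and simple, considered up to isomorphism; the order of a graph is its number of vertices. $P_k$, $C_k$ and $K_k$ denote the path, cycle and complete graph of order $k$. For a graph $G=(V,E)$ and $D\subseteq V$, $N[D]$ is the set of vertices that belong to $D$ or have a neighbor in $D$. A set $D\subseteq V$ is isolating if $V\setminus N[D]$ is an independent set. The isolation number $\iota(G)$ is the minimum cardinality of an isolating set of $G$. A cut vertex of a connected graph is a vertex whose removal results in a disconnected graph. A block of a graph $G$ is a maximal connected subgraph of $G$ without cut vertices (of its own). A block graph is a connected graph all of whose blocks are complete graphs. Attachable graphs. Each of the following graphs has one distinguished ("circled") vertex: $P_3$, whose circled vertex is one of its leaves; $C_3$, whose circled vertex is any of its vertices; and $H_6^1, H_6^{2a}, H_6^{2b}, H_6^3$, each of which consists of an (induced) cycle $C_5$ together with a sixth vertex, the circled one, which is adjacent to, respectively, exactly one vertex of the cycle ($H_6^1$), exactly two vertices of the cycle (the two graphs $H_6^{2a}$ and $H_6^{2b}$: one in which these two vertices are adjacent in the cycle, the other in which they are not), and exactly three vertices of the cycle, which are consecutive in the cycle ($H_6^3$). The family $\mathcal{G}$ consists of all graphs obtained from a connected graph $G_0$ (with at least one vertex) by attaching at every vertex $v$ of $G_0$ exactly one copy of one of the graphs $P_3, C_3, H_6^1, H_6^{2a}, H_6^{2b}, H_6^3$, by identifying $v$ with the circled vertex of the attached copy (copies attached at different vertices are disjoint, and the choice of the attached graph may vary from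 vertex to vertex). $\mathcal{B}$ is the family of all block graphs belonging to $\mathcal{G}$; equivalently, the graphs obtained by attaching in this way a copy of $P_3$ or $C_3$ at every vertex of a block graph $G_0$. *)

theory Defs
  imports Complex_Main "Graph_Theory.Graph_Theory"
begin

text \<open>
  Finite simple graphs are the members of the locale \<^locale>\<open>graph\<close>: finite, symmetric digraphs
  without loops and parallel arcs. An edge is represented by its two arcs, so adjacency of
  \<open>u\<close> and \<open>v\<close> is \<^term>\<open>u \<rightarrow>\<^bsub>G\<^esub> v\<close>.
\<close>

definition closed_neighborhood :: "('a,'b) pre_digraph \<Rightarrow> 'a set \<Rightarrow> 'a set" where
  "closed_neighborhood G D = {v \<in> verts G. v \<in> D \<or> (\<exists>u\<in>D. v \<rightarrow>\<^bsub>G\<^esub> u)}"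

definition independent_set :: "('a,'b) pre_digraph \<Rightarrow> 'a set \<Rightarrow> bool" where
  "independent_set G S \<longleftrightarrow> S \<subseteq> verts G \<and> (\<forall>u\<in>S. \<forall>v\<in>S. \<not> u \<rightarrow>\<^bsub>G\<^esub> v)"

definition isolating_set :: "('a,'b) pre_digraph \<Rightarrow> 'a set \<Rightarrow> bool" where
  "isolating_set G D \<longleftrightarrow>
     D \<subseteq> verts G \<and> independent_set G (verts G - closed_neighborhood G D)"

definition isolation_number :: "('a,'b) pre_digraph \<Rightarrow> nat" where
  "isolation_number G = Min (card ` {D. isolating_set G D})"


text \<open>
  \<^const>\<open>Digraph_Component.connected\<close> is false for the null graph, which is neither connected nor
  disconnected here: the only vertex of a graph of order 1 is not a cut vertex.
\<close>

definition cut_vertex :: "('a,'b) pre_digraph \<Rightarrow> 'a \<Rightarrow> bool" where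
  "cut_vertex G v \<longleftrightarrow>
     v \<in> verts G \<and> verts (pre_digraph.del_vert G v) \<noteq> {} \<and>
     \<not> Digraph_Component.connected (pre_digraph.del_vert G v)"

text \<open>
  The conjunct \<^term>\<open>graph H\<close> is needed because \<^const>\<open>subgraph\<close> also admits subdigraphs that
  contain only one of the two arcs of an edge.
\<close>

definition block :: "('a,'b) pre_digraph \<Rightarrow> ('a,'b) pre_digraph \<Rightarrow> bool" where
  "block G = pre_digraph.max_subgraph G
     (\<lambda>H. graph H \<and> Digraph_Component.connected H \<and> (\<forall>v. \<not> cut_vertex H v))"

definition block_graph :: "('a,'b) pre_digraph \<Rightarrow> bool" where
  "block_graph G \<longleftrightarrow>
     graph G \<and> Digraph_Component.connected G \<and>
     (\<forall>B. block G B \<longrightarrow> (\<exists>k. complete_digraph k B))"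


text \<open>
  The attachable graphs live on an initial segment of \<^typ>\<open>nat\<close>, and the circled vertex is
  always \<open>0\<close>. In the graphs of order 6 the cycle is 1, 2, 3, 4, 5.
\<close>

definition graph_of_edges :: "nat \<Rightarrow> (nat \<times> nat) set \<Rightarrow> nat pair_pre_digraph" where
  "graph_of_edges k E = \<lparr> pverts = {..<k}, parcs = E \<union> E\<inverse> \<rparr>"

definition C5_edges :: "(nat \<times> nat) set" where
  "C5_edges = {(1,2), (2,3), (3,4), (4,5), (5,1)}"

definition P3 :: "nat pair_pre_digraph" where
  "P3 = graph_of_edges 3 {(0,1), (1,2)}"

definition C3 :: "nat pair_pre_digraph" where
  "C3 = graph_of_edges 3 {(0,1), (1,2), (2,0)}"

definition H6_1 :: "nat pair_pre_digraph" where
  "H6_1 = graph_of_edges 6 (C5_edges \<union> {(0,1)})"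

definition H6_2a :: "nat pair_pre_digraph" where
  "H6_2a = graph_of_edges 6 (C5_edges \<union> {(0,1), (0,2)})"

definition H6_2b :: "nat pair_pre_digraph" where
  "H6_2b = graph_of_edges 6 (C5_edges \<union> {(0,1), (0,3)})"

definition H6_3 :: "nat pair_pre_digraph" where
  "H6_3 = graph_of_edges 6 (C5_edges \<union> {(0,1), (0,2), (0,3)})"

definition attachable :: "nat pair_pre_digraph set" where
  "attachable = {P3, C3, H6_1, H6_2a, H6_2b, H6_3}"

text \<open>
  The vertex \<open>(v, i)\<close> is the vertex \<open>i\<close> of the copy attached at \<open>v\<close>; the vertex \<open>v\<close> of \<open>G\<^sub>0\<close> itself
  is \<open>(v, 0)\<close>.
\<close>

definition attach ::
    "('a,'b) pre_digraph \<Rightarrow> ('a \<Rightarrow> nat pair_pre_digraph) \<Rightarrow> ('a \<times> nat) pair_pre_digraph" where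
  "attach G\<^sub>0 A =
     \<lparr> pverts = (SIGMA v:verts G\<^sub>0. pverts (A v)),
       parcs = {((v,i), (v,j)) | v i j. v \<in> verts G\<^sub>0 \<and> (i,j) \<in> parcs (A v)}
             \<union> {((u,0), (v,0)) | u v. u \<rightarrow>\<^bsub>G\<^sub>0\<^esub> v} \<rparr>"

text \<open>
  Membership is up to isomorphism. Taking the vertices of \<open>G\<^sub>0\<close> from the vertex type of \<open>G\<close> loses
  nothing, since \<open>G\<close> contains a copy of \<open>G\<^sub>0\<close>.
\<close>

definition family_G :: "('a,'b) pre_digraph set" where
  "family_G = {G. \<exists>(G\<^sub>0 :: 'a pair_pre_digraph) A.
     pair_graph G\<^sub>0 \<and> Digraph_Component.connected (with_proj G\<^sub>0) \<and>
     (\<forall>v \<in> pverts G\<^sub>0. A v \<in> attachable) \<and>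
     digraph_iso G (with_proj (attach (with_proj G\<^sub>0) A))}"

definition family_B :: "('a,'b) pre_digraph set" where
  "family_B = {G \<in> family_G. block_graph G}"

end

theory Submission
  imports Defs
begin

text \<open>
  In a block graph every cycle spans a clique, because its vertices lie in a common block. Hence, for
  the distances from a root, adjacent vertices at the same distance have the same parent, and
  parents are unique: the edges are those of a rooted tree together with some edges between siblings.

  By induction on such structures, a graph of order \<open>n \<noteq> 2\<close> either has an isolating set of size less
  than \<open>n / 3\<close> or decomposes into triples inducing \<open>P\<^sub>3\<close> or \<open>C\<^sub>3\<close> that are joined only through their circled
  vertices. Remove the subtree \<open>S\<close> of the parent \<open>p\<close> of a deepest vertex if some such parent has two
  children, and that of its grandparent \<open>p\<close> otherwise. Then \<open>card S \<ge> 3\<close>, the set \<open>{p}\<close> isolates \<open>S\<close>, and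
  \<open>S\<close> is attached to the rest through \<open>p\<close> only, so one vertex more suffices for \<open>card S\<close> vertices more.
  If equality persists, then \<open>S\<close> is a further triple and \<open>p\<close> is adjacent to circled vertices only.

  Conversely, in a copy of order 3 or 6 every isolating set has at least 1 or 2 elements, even if the
  circled vertex is dominated from outside, and \<open>{0}\<close> or \<open>{0, 4}\<close> attains this.
\<close>

section \<open>Isolation in trees with edges between siblings\<close>

text \<open>The relation stays fixed while the vertex set varies, so that induced subgraphs are mere
  sets and removing a subtree is a set difference.\<close>

locale adjacency =
  fixes E :: "'a rel"
  assumes sym: "(x, y) \<in> E \<Longrightarrow> (y, x) \<in> E"
    and irrefl: "(x, x) \<notin> E"
begin

definition dominated :: "'a set \<Rightarrow> 'a set" where
  "dominated D = D \<union> E `` D"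

definition isolates :: "'a set \<Rightarrow> 'a set \<Rightarrow> bool" where
  "isolates V D \<longleftrightarrow> D \<subseteq> V \<and>
     (\<forall>u\<in>V. \<forall>v\<in>V. (u, v) \<in> E \<longrightarrow> u \<in> dominated D \<or> v \<in> dominated D)"

text \<open>
  The copy attached at \<open>c \<in> C\<close> consists of \<open>c\<close>, \<open>a c\<close> and \<open>b c\<close>; it is \<open>C\<^sub>3\<close> or \<open>P\<^sub>3\<close> according to whether
  \<open>b c\<close> is adjacent to \<open>c\<close>. The last conjunct is all that the induction needs of the connectedness of
  the graph induced by \<open>C\<close>.
\<close>

definition pendant_triples :: "'a set \<Rightarrow> 'a set \<Rightarrow> ('a \<Rightarrow> 'a) \<Rightarrow> ('a \<Rightarrow> 'a) \<Rightarrow> bool" where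
  "pendant_triples V C a b \<longleftrightarrow>
     finite C \<and> V = C \<union> a ` C \<union> b ` C \<and>
     C \<inter> a ` C = {} \<and> C \<inter> b ` C = {} \<and> a ` C \<inter> b ` C = {} \<and> inj_on a C \<and> inj_on b C \<and>
     (\<forall>c\<in>C. (c, a c) \<in> E \<and> (a c, b c) \<in> E \<and>
        (\<forall>x\<in>V. (a c, x) \<in> E \<longrightarrow> x = c \<or> x = b c) \<and>
        (\<forall>x\<in>V. (b c, x) \<in> E \<longrightarrow> x = c \<or> x = a c) \<and>
        (C = {c} \<or> (\<exists>c'\<in>C. (c, c') \<in> E)))"

text \<open>The functions are total and constrained on \<open>V\<close> only, so the same
  \<open>par\<close> and \<open>d\<close> serve every set that is left after a full subtree has been
  removed.\<close>

definition sibling_tree :: "'a set \<Rightarrow> 'a \<Rightarrow> ('a \<Rightarrow> 'a) \<Rightarrow> ('a \<Rightarrow> nat) \<Rightarrow> bool" where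
  "sibling_tree V r par d \<longleftrightarrow>
     finite V \<and> r \<in> V \<and> d r = 0 \<and>
     (\<forall>x\<in>V - {r}. par x \<in> V \<and> (x, par x) \<in> E \<and> d x = Suc (d (par x))) \<and>
     (\<forall>x\<in>V. \<forall>y\<in>V. (x, y) \<in> E \<longrightarrow>
        x \<noteq> r \<and> y = par x \<or> y \<noteq> r \<and> x = par y \<or> x \<noteq> r \<and> y \<noteq> r \<and> par x = par y)"

text \<open>The invariant of the induction: if every isolating set of \<open>V\<close> has at least
  a third of its vertices, the second alternative is forced.\<close>

definition small_or_pendant :: "'a set \<Rightarrow> bool" where
  "small_or_pendant V \<longleftrightarrow>
     (\<exists>D. isolates V D \<and> 3 * card D < card V) \<or> (\<exists>C a b. pendant_triples V C a b)"

lemma isolatesI_small: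
  assumes "isolates V D" "3 * card D < card V"
  shows "small_or_pendant V"
  using assms by (auto simp: small_or_pendant_def)

section \<open>Pendant triples\<close>

lemma card_pendant_triples:
  assumes "pendant_triples V C a b"
  shows "card V = 3 * card C"
proof -
  have "finite C" "V = C \<union> a ` C \<union> b ` C" "inj_on a C" "inj_on b C"
    "C \<inter> a ` C = {}" "(C \<union> a ` C) \<inter> b ` C = {}"
    using assms by (auto simp: pendant_triples_def)
  then show ?thesis
    by (simp add: card_Un_disjoint card_image)
qed

lemma pendant_triples_neighbour:
  assumes "pendant_triples V C a b" "c \<in> C" "x \<in> V"
  shows "(a c, x) \<in> E \<Longrightarrow> x = c \<or> x = b c" "(b c, x) \<in> E \<Longrightarrow> x = c \<or> x = a c"
  using assms unfolding pendant_triples_def by blast+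

lemma pendant_triples_edge:
  assumes "pendant_triples V C a b" "c \<in> C"
  shows "(c, a c) \<in> E" "(a c, b c) \<in> E" "c \<in> V" "a c \<in> V" "b c \<in> V" "a c \<notin> C" "b c \<notin> C"
  using assms by (auto simp: pendant_triples_def)

lemma pendant_triples_circled_neighbour:
  assumes "pendant_triples V C a b" "c \<in> C"
  shows "C = {c} \<or> (\<exists>c'\<in>C. (c, c') \<in> E)"
  using assms by (simp add: pendant_triples_def)

text \<open>Only vertices \<open>b c\<close> can escape domination by \<open>C\<close>, and each of
  them has no neighbours other than \<open>c\<close> and \<open>a c\<close>, which are
  dominated.\<close>

lemma isolates_pendant_triples:
  assumes "pendant_triples V C a b"
  shows "isolates V C"
proof -
  have "u \<in> dominated C \<or> v \<in> dominated C" if "u \<in> V" "v \<in> V" "(u, v) \<in> E" for u v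
  proof (cases "u \<in> C \<union> a ` C")
    case True
    with assms show ?thesis
      by (auto simp: pendant_triples_def dominated_def)
  next
    case False
    with that assms obtain c where c: "c \<in> C" "u = b c"
      unfolding pendant_triples_def by blast
    with assms that have "v = c \<or> v = a c"
      using pendant_triples_neighbour(2) by blast
    with assms c show ?thesis
      using pendant_triples_edge[OF assms c(1)] by (auto simp: dominated_def)
  qed
  with assms show ?thesis
    by (auto simp: isolates_def pendant_triples_def)
qed

lemma pendant_triple_singleton:
  assumes "distinct [p, s, t]" "(p, s) \<in> E" "(s, t) \<in> E"
  shows "\<exists>a b. pendant_triples {p, s, t} {p} a b"
  using assms sym irrefl
  by (intro exI[of _ "\<lambda>_. s"] exI[of _ "\<lambda>_. t"]) (auto simp: pendant_triples_def)

text \<open>If \<open>s\<close> and \<open>t\<close> are not adjacent, the triple is the path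
  \<open>s\<close>, \<open>p\<close>, \<open>t\<close>, and its leaf \<open>s\<close> takes the role
  of the circled vertex.\<close>

lemma small_or_pendant_triple:
  assumes "distinct [p, s, t]" "(p, s) \<in> E" "(s, t) \<in> E \<or> (p, t) \<in> E"
  shows "small_or_pendant {p, s, t}"
proof (cases "(s, t) \<in> E")
  case True
  then show ?thesis
    using assms pendant_triple_singleton[of p s t] by (auto simp: small_or_pendant_def)
next
  case False
  have "{p, s, t} = {s, p, t}"
    by auto
  with False show ?thesis
    using assms sym pendant_triple_singleton[of s p t] by (auto simp: small_or_pendant_def)
qed

section \<open>Adding one triple\<close>

text \<open>If \<open>s\<close> and \<open>t\<close> are adjacent, then \<open>p\<close>,
  \<open>s\<close>, \<open>t\<close> is a new triple with circled vertex \<open>p\<close>. Otherwise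
  every edge not inside \<open>V\<close> contains \<open>p\<close>, which the circled vertex
  \<open>x\<close> already dominates, so \<open>C\<close> isolates the larger set without
  growing.\<close>

lemma extend_at_circled:
  assumes P: "pendant_triples V C a b"
    and dist: "distinct [p, s, t]" "p \<notin> V" "s \<notin> V" "t \<notin> V"
    and st: "\<And>x. x \<in> V \<Longrightarrow> (s, x) \<notin> E \<and> (t, x) \<notin> E"
    and ps: "(p, s) \<in> E" and t: "(s, t) \<in> E \<or> (p, t) \<in> E"
    and x: "x \<in> V" "(p, x) \<in> E"
    and circled: "\<And>x. x \<in> V \<Longrightarrow> (p, x) \<in> E \<Longrightarrow> x \<in> C"
  shows "small_or_pendant (V \<union> {p, s, t})"
proof (cases "(s, t) \<in> E")
  case True
  have CV: "C \<subseteq> V" "a ` C \<subseteq> V" "b ` C \<subseteq> V"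
    using P by (auto simp: pendant_triples_def)
  have im: "(a(p := s)) ` C = a ` C" "(b(p := t)) ` C = b ` C"
    using dist CV by (auto simp: image_iff)
  have "pendant_triples (V \<union> {p, s, t}) (insert p C) (a(p := s)) (b(p := t))"
    unfolding pendant_triples_def
  proof (intro conjI ballI)
    show "finite (insert p C)"
      using P by (simp add: pendant_triples_def)
    show "V \<union> {p, s, t} = insert p C \<union> (a(p := s)) ` insert p C \<union> (b(p := t)) ` insert p C"
      using P im by (auto simp: pendant_triples_def)
    show "insert p C \<inter> (a(p := s)) ` insert p C = {}" "insert p C \<inter> (b(p := t)) ` insert p C = {}"
      "(a(p := s)) ` insert p C \<inter> (b(p := t)) ` insert p C = {}"
      using P im CV dist unfolding pendant_triples_def by auto
    show "inj_on (a(p := s)) (insert p C)" "inj_on (b(p := t)) (insert p C)"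
      using P dist CV unfolding pendant_triples_def inj_on_def by auto
  next
    fix c assume c: "c \<in> insert p C"
    have xC: "x \<in> C"
      using circled x by blast
    show "(c, (a(p := s)) c) \<in> E" "((a(p := s)) c, (b(p := t)) c) \<in> E"
      using c P ps True unfolding pendant_triples_def by auto
    show "insert p C = {c} \<or> (\<exists>c'\<in>insert p C. (c, c') \<in> E)"
    proof (cases "c = p")
      case True
      with xC x show ?thesis by blast
    next
      case False
      then have "C = {c} \<or> (\<exists>c'\<in>C. (c, c') \<in> E)"
        using c P unfolding pendant_triples_def by blast
      \<comment> \<open>If \<open>c\<close> was the only circled vertex, then \<open>x = c\<close>,
        and \<open>p\<close> is its circled neighbour.\<close>
      then show ?thesis
        using xC x sym by blast
    qed
    fix y assume y: "y \<in> V \<union> {p, s, t}"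
    have nb: "(z, s) \<notin> E" "(z, t) \<notin> E" if "z \<in> V" for z
      using st sym that by blast+
    show "((a(p := s)) c, y) \<in> E \<longrightarrow> y = c \<or> y = (b(p := t)) c"
    proof (cases "c = p")
      case True
      then show ?thesis using y st irrefl by auto
    next
      case False
      then have "c \<in> C" using c by simp
      then have "a c \<in> V" "a c \<notin> C" using pendant_triples_edge[OF P] by auto
      then have "(a c, p) \<notin> E" using circled sym by blast
      then show ?thesis
        using False \<open>c \<in> C\<close> \<open>a c \<in> V\<close> y nb pendant_triples_neighbour(1)[OF P] by auto
    qed
    show "((b(p := t)) c, y) \<in> E \<longrightarrow> y = c \<or> y = (a(p := s)) c"
    proof (cases "c = p")
      case True
      then show ?thesis using y st irrefl by auto
    next
      case False
      then have "c \<in> C" using c by simp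
      then have "b c \<in> V" "b c \<notin> C" using pendant_triples_edge[OF P] by auto
      then have "(b c, p) \<notin> E" using circled sym by blast
      then show ?thesis
        using False \<open>c \<in> C\<close> \<open>b c \<in> V\<close> y nb pendant_triples_neighbour(2)[OF P] by auto
    qed
  qed
  then show ?thesis
    by (auto simp: small_or_pendant_def)
next
  case False
  then have pt: "(p, t) \<in> E" using t by simp
  have C: "isolates V C"
    using P by (rule isolates_pendant_triples)
  have "x \<in> C" using circled x by blast
  then have p: "p \<in> dominated C"
    using x sym by (auto simp: dominated_def)
  have "isolates (V \<union> {p, s, t}) C"
    unfolding isolates_def
  proof (intro conjI ballI impI)
    show "C \<subseteq> V \<union> {p, s, t}"
      using C by (auto simp: isolates_def)
    fix u v assume uv: "u \<in> V \<union> {p, s, t}" "v \<in> V \<union> {p, s, t}" "(u, v) \<in> E"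
    have "u = p \<or> v = p \<or> u \<in> V \<and> v \<in> V"
      using uv st sym irrefl False by blast
    then show "u \<in> dominated C \<or> v \<in> dominated C"
      using p C uv by (auto simp: isolates_def)
  qed
  moreover have "3 * card C < card (V \<union> {p, s, t})"
  proof -
    have "finite V" using P by (auto simp: pendant_triples_def)
    then have "card V < card (V \<union> {p, s, t})"
      using dist by (intro psubset_card_mono) auto
    then show ?thesis
      using card_pendant_triples[OF P] by simp
  qed
  ultimately show ?thesis
    by (rule isolatesI_small)
qed

text \<open>An edge not inside \<open>V\<close> contains \<open>p\<close> or \<open>s\<close>, since
  \<open>t\<close> has no neighbours in \<open>V\<close>; and \<open>p\<close> dominates
  both.\<close>

lemma isolates_singleton_le_one:
  assumes st: "\<And>x. x \<in> V \<Longrightarrow> (s, x) \<notin> E \<and> (t, x) \<notin> E"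
    and ps: "(p, s) \<in> E"
    and V: "\<And>u v. u \<in> V \<Longrightarrow> v \<in> V \<Longrightarrow> (u, v) \<in> E \<Longrightarrow> (p, u) \<in> E \<or> (p, v) \<in> E"
  shows "isolates (V \<union> {p, s, t}) {p}"
  unfolding isolates_def
proof (intro conjI ballI impI)
  fix u v assume uv: "u \<in> V \<union> {p, s, t}" "v \<in> V \<union> {p, s, t}" "(u, v) \<in> E"
  have "u = p \<or> v = p \<or> u = s \<or> v = s \<or> u \<in> V \<and> v \<in> V"
    using uv st sym irrefl by blast
  then show "u \<in> dominated {p} \<or> v \<in> dominated {p}"
    using ps V uv by (auto simp: dominated_def)
qed auto

text \<open>
  If \<open>{p}\<close> is not isolating, then \<open>p\<close> has a single neighbour in the triple, and the triple can be
  relabelled so that this neighbour becomes its circled vertex.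
\<close>

lemma extend_at_triple:
  assumes d: "distinct [c, a, b, p, s, t]"
    and E: "(c, a) \<in> E" "(a, b) \<in> E"
    and st: "\<And>x. x \<in> {c, a, b} \<Longrightarrow> (s, x) \<notin> E \<and> (t, x) \<notin> E"
    and ps: "(p, s) \<in> E" and t: "(s, t) \<in> E \<or> (p, t) \<in> E"
    and x: "x \<in> {c, a, b}" "(p, x) \<in> E"
  shows "small_or_pendant ({c, a, b} \<union> {p, s, t})"
proof (cases "isolates ({c, a, b} \<union> {p, s, t}) {p}")
  case True
  moreover have "3 * card {p} < card ({c, a, b} \<union> {p, s, t})"
    using distinct_card[OF d] by (simp add: insert_commute)
  ultimately show ?thesis
    by (rule isolatesI_small)
next
  case False
  then obtain u v where uv: "u \<in> {c, a, b}" "v \<in> {c, a, b}" "(u, v) \<in> E"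
    "(p, u) \<notin> E" "(p, v) \<notin> E"
    using isolates_singleton_le_one[OF st ps] by blast
  \<comment> \<open>The edge missed by \<open>{p}\<close> consists of the two vertices other than
    \<open>x\<close>. As the triple is connected, it can be read as a path \<open>x\<close>,
    \<open>w\<close>, \<open>z\<close> whose last two vertices are not adjacent to
    \<open>p\<close>.\<close>
  obtain w z where w: "{c, a, b} = {x, w, z}" "distinct [x, w, z]" "(x, w) \<in> E" "(w, z) \<in> E"
    and p: "(p, w) \<notin> E" "(p, z) \<notin> E"
  proof -
    have uvx: "{c, a, b} = {x, u, v}" "distinct [x, u, v]"
      using uv x irrefl by auto
    moreover have "(x, u) \<in> E \<or> (x, v) \<in> E"
    proof -
      have "\<exists>z\<in>{c, a, b}. (x, z) \<in> E"
        using x E sym by blast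
      then show ?thesis
        using uvx irrefl by auto
    qed
    ultimately show thesis
      using that[of u v] that[of v u] uv sym by auto
  qed
  obtain a' b' where P: "pendant_triples {x, w, z} {x} a' b'"
    using pendant_triple_singleton w by blast
  have "p \<notin> {c, a, b}" "s \<notin> {c, a, b}" "t \<notin> {c, a, b}" "distinct [p, s, t]"
    using d by auto
  then show ?thesis
    using extend_at_circled[OF P, of p s t x] st ps t x w p by auto
qed

text \<open>
  As \<open>p\<close> dominates a non-circled vertex of the triple at \<open>c\<close> and \<open>c'\<close> dominates \<open>c\<close>, the vertex \<open>p\<close> can
  replace \<open>c\<close> in the isolating set \<open>C\<close>.
\<close>

lemma extend_at_pendant:
  assumes P: "pendant_triples V C a b"
    and dist: "distinct [p, s, t]" "p \<notin> V" "s \<notin> V" "t \<notin> V"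
    and st: "\<And>x. x \<in> V \<Longrightarrow> (s, x) \<notin> E \<and> (t, x) \<notin> E"
    and ps: "(p, s) \<in> E"
    and c: "c \<in> C" "c' \<in> C" "(c, c') \<in> E"
    and px: "(p, a c) \<in> E \<or> (p, b c) \<in> E"
  shows "small_or_pendant (V \<union> {p, s, t})"
proof -
  let ?D = "insert p (C - {c})"
  have C: "finite C" "C \<subseteq> V" and V: "V = C \<union> a ` C \<union> b ` C"
    using P unfolding pendant_triples_def by auto
  have "c' \<noteq> c"
    using c irrefl by blast
  have pC: "p \<notin> C"
    using C dist by blast
  \<comment> \<open>After the exchange the undominated vertices are among \<open>t\<close>, the one
    of \<open>a c\<close> and \<open>b c\<close> that may be non-adjacent to \<open>p\<close>, and
    the \<open>b e\<close> of the other triples.\<close>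
  have und: "y = a c \<and> (p, y) \<notin> E \<or> y = b c \<and> (p, y) \<notin> E \<or> y = t \<or> (\<exists>e\<in>C. y = b e \<and> e \<noteq> c)"
    if y: "y \<in> V \<union> {p, s, t}" "y \<notin> dominated ?D" for y
  proof -
    have "y \<noteq> p" "y \<noteq> s" "(p, y) \<notin> E"
      using y ps by (auto simp: dominated_def)
    moreover have "y \<noteq> c"
      using y c \<open>c' \<noteq> c\<close> sym[OF c(3)] by (auto simp: dominated_def)
    moreover have "y \<noteq> a e" if "e \<in> C" "e \<noteq> c" for e
      using y that pendant_triples_edge[OF P that(1)] by (auto simp: dominated_def)
    moreover have "y \<notin> C - {c}"
      using y by (auto simp: dominated_def)
    ultimately show ?thesis
      using y(1) unfolding V by blast
  qed
  \<comment> \<open>Such a \<open>b e\<close> is harmless: its neighbours \<open>e\<close> and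
    \<open>a e\<close> are dominated by \<open>e\<close>, which stays in \<open>?D\<close>.\<close>
  have sec: "e = c" if "e \<in> C" "u = b e" "v \<in> V \<union> {p, s, t}" "v \<notin> dominated ?D" "(u, v) \<in> E" for e u v
  proof (rule ccontr)
    assume "e \<noteq> c"
    have "u \<in> V"
      using that pendant_triples_edge[OF P] by blast
    then have "v \<noteq> s" "v \<noteq> t"
      using st sym that by blast+
    moreover have "v \<noteq> p"
      using that by (auto simp: dominated_def)
    ultimately have "v = e \<or> v = a e"
      using that pendant_triples_neighbour(2)[OF P] by blast
    with that \<open>e \<noteq> c\<close> pendant_triples_edge[OF P that(1)] show False
      by (auto simp: dominated_def)
  qed
  have "isolates (V \<union> {p, s, t}) ?D"
    unfolding isolates_def
  proof (intro conjI ballI impI)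
    show "?D \<subseteq> V \<union> {p, s, t}"
      using C by blast
    fix u v assume uv: "u \<in> V \<union> {p, s, t}" "v \<in> V \<union> {p, s, t}" "(u, v) \<in> E"
    show "u \<in> dominated ?D \<or> v \<in> dominated ?D"
    proof (rule ccontr)
      assume "\<not> ?thesis"
      then have nd: "u \<notin> dominated ?D" "v \<notin> dominated ?D"
        by auto
      have "u \<noteq> b e" "v \<noteq> b e" if "e \<in> C" "e \<noteq> c" for e
        using sec that uv nd sym by blast+
      then have "u = a c \<and> (p, u) \<notin> E \<or> u = b c \<and> (p, u) \<notin> E \<or> u = t"
        "v = a c \<and> (p, v) \<notin> E \<or> v = b c \<and> (p, v) \<notin> E \<or> v = t"
        using und[OF uv(1) nd(1)] und[OF uv(2) nd(2)] by blast+
      \<comment> \<open>The remaining candidates, \<open>t\<close> and one of \<open>a c\<close> and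
        \<open>b c\<close>, are not adjacent.\<close>
      moreover have "(t, a c) \<notin> E" "(t, b c) \<notin> E" "(a c, t) \<notin> E" "(b c, t) \<notin> E"
        using st pendant_triples_edge[OF P c(1)] sym by blast+
      ultimately show False
        using px uv(3) irrefl by auto
    qed
  qed
  moreover have "3 * card ?D < card (V \<union> {p, s, t})"
  proof -
    have "card ?D = card C"
      using C pC c card_Suc_Diff1[of C c] by simp
    moreover have "finite V"
      using C V by auto
    then have "card V < card (V \<union> {p, s, t})"
      using dist by (intro psubset_card_mono) auto
    ultimately show ?thesis
      using card_pendant_triples[OF P] by simp
  qed
  ultimately show ?thesis
    by (rule isolatesI_small)
qed

text \<open>If \<open>p\<close> has a non-circled neighbour, in the triple at \<open>c\<close> say,
  exchanging \<open>c\<close> for \<open>p\<close> requires a circled neighbour of \<open>c\<close>.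
  It is missing only if \<open>C = {c}\<close>, and then the six vertices are treated
  directly.\<close>

lemma extend_pendant_triples:
  assumes P: "pendant_triples V C a b"
    and dist: "distinct [p, s, t]" "p \<notin> V" "s \<notin> V" "t \<notin> V"
    and st: "\<And>x. x \<in> V \<Longrightarrow> (s, x) \<notin> E \<and> (t, x) \<notin> E"
    and ps: "(p, s) \<in> E" and t: "(s, t) \<in> E \<or> (p, t) \<in> E"
    and x: "x \<in> V" "(p, x) \<in> E"
  shows "small_or_pendant (V \<union> {p, s, t})"
proof (cases "\<forall>y\<in>V. (p, y) \<in> E \<longrightarrow> y \<in> C")
  case True
  then show ?thesis
    using extend_at_circled[OF P dist st ps t x] by blast
next
  case False
  then obtain y where y: "y \<in> V" "(p, y) \<in> E" "y \<notin> C"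
    by blast
  moreover have "V = C \<union> a ` C \<union> b ` C"
    using P by (simp add: pendant_triples_def)
  ultimately obtain c where c: "c \<in> C" "y = a c \<or> y = b c"
    by blast
  show ?thesis
  proof (cases "C = {c}")
    case True
    then have V: "V = {c, a c, b c}"
      using P by (auto simp: pendant_triples_def)
    have "distinct [c, a c, b c]"
      using P True by (auto simp: pendant_triples_def)
    then have "distinct [c, a c, b c, p, s, t]"
      using dist V by auto
    then show ?thesis
      using extend_at_triple[of c "a c" "b c" p s t y] pendant_triples_edge[OF P c(1)] st ps t y V by simp
  next
    case False
    then obtain c' where "c' \<in> C" "(c, c') \<in> E"
      using pendant_triples_circled_neighbour[OF P c(1)] False by blast
    then show ?thesis
      using extend_at_pendant[OF P dist st ps c(1)] c(2) y(2) by blast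
  qed
qed

section \<open>Adding a subtree\<close>

text \<open>All edges between \<open>V\<close> and \<open>S\<close> contain \<open>p\<close>, and
  \<open>{p}\<close> isolates \<open>S\<close>, so one more vertex pays for at least three more.
  Strictness is in doubt only if \<open>V\<close> consists of pendant triples and
  \<open>card S = 3\<close>, which is the addition of one triple.\<close>

lemma extend_small_or_pendant:
  assumes fin: "finite V" "finite S" and disj: "V \<inter> S = {}"
    and V: "card V = 2 \<or> small_or_pendant V"
    and pS: "p \<in> S" and card: "card S \<ge> 3"
    and triple: "card S = 3 \<Longrightarrow> \<exists>s t. S = {p, s, t} \<and> (p, s) \<in> E \<and> ((s, t) \<in> E \<or> (p, t) \<in> E)"
    and S: "\<And>u v. u \<in> S \<Longrightarrow> v \<in> S \<Longrightarrow> (u, v) \<in> E \<Longrightarrow> u \<in> dominated {p} \<or> v \<in> dominated {p}"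
    and VS: "\<And>u v. u \<in> V \<Longrightarrow> v \<in> S \<Longrightarrow> (u, v) \<in> E \<Longrightarrow> v = p"
    and x: "x \<in> V" "(p, x) \<in> E"
  shows "small_or_pendant (V \<union> S)"
proof -
  have cardVS: "card (V \<union> S) = card V + card S"
    using fin disj by (rule card_Un_disjoint)
  have edge: "u = p \<or> v = p \<or> u \<in> V \<and> v \<in> V \<or> u \<in> S \<and> v \<in> S"
    if "u \<in> V \<union> S" "v \<in> V \<union> S" "(u, v) \<in> E" for u v
    using that VS sym by blast
  have ins: "isolates (V \<union> S) (insert p D)" if "isolates V D" for D
    unfolding isolates_def
  proof (intro conjI ballI impI)
    show "insert p D \<subseteq> V \<union> S"
      using that pS by (auto simp: isolates_def)
    fix u v assume uv: "u \<in> V \<union> S" "v \<in> V \<union> S" "(u, v) \<in> E"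
    have "dominated D \<subseteq> dominated (insert p D)" "dominated {p} \<subseteq> dominated (insert p D)"
      "p \<in> dominated (insert p D)"
      by (auto simp: dominated_def)
    then show "u \<in> dominated (insert p D) \<or> v \<in> dominated (insert p D)"
      using edge[OF uv] S[OF _ _ uv(3)] that uv(3) unfolding isolates_def by blast
  qed
  from V consider "card V = 2" | D where "isolates V D" "3 * card D < card V"
    | C a b where "pendant_triples V C a b"
    by (auto simp: small_or_pendant_def)
  then show ?thesis
  proof cases
    case 1
    then obtain y z where yz: "V = {y, z}"
      by (auto simp: card_2_iff)
    \<comment> \<open>For order 2 nothing is known about small isolating sets of \<open>V\<close>.
      But an edge inside \<open>V\<close> contains \<open>x\<close>, which \<open>p\<close>
      dominates, so \<open>{p}\<close> suffices for at least five vertices.\<close>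
    have "isolates (V \<union> S) {p}"
      unfolding isolates_def
    proof (intro conjI ballI impI)
      show "{p} \<subseteq> V \<union> S"
        using pS by simp
      fix u v assume uv: "u \<in> V \<union> S" "v \<in> V \<union> S" "(u, v) \<in> E"
      have "u = x \<or> v = x" if "u \<in> V" "v \<in> V"
        using that yz x irrefl uv(3) by auto
      then show "u \<in> dominated {p} \<or> v \<in> dominated {p}"
        using edge[OF uv] S[OF _ _ uv(3)] x(2) by (auto simp: dominated_def)
    qed
    moreover have "3 * card {p} < card (V \<union> S)"
      using 1 card cardVS by simp
    ultimately show ?thesis
      by (rule isolatesI_small)
  next
    case 2
    have "card (insert p D) \<le> Suc (card D)"
      by (rule card_insert_le_m1) auto
    then have "3 * card (insert p D) < card (V \<union> S)"
      using 2(2) card cardVS by linarith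
    with ins[OF 2(1)] show ?thesis
      by (rule isolatesI_small)
  next
    case 3
    show ?thesis
    proof (cases "card S = 3")
      case True
      then obtain s t where st: "S = {p, s, t}" "(p, s) \<in> E" "(s, t) \<in> E \<or> (p, t) \<in> E"
        using triple by blast
      have d: "distinct [p, s, t]"
        using True st(1) card_distinct[of "[p, s, t]"] by simp
      have no: "(s, y) \<notin> E \<and> (t, y) \<notin> E" if "y \<in> V" for y
        using VS[OF that] sym st(1) d by auto
      show ?thesis
        using extend_pendant_triples[OF 3 d _ _ _ no st(2,3) x] disj st(1) by auto
    next
      case False
      have "card (insert p C) \<le> Suc (card C)"
        by (rule card_insert_le_m1) auto
      then have "3 * card (insert p C) < card (V \<union> S)"
        using card_pendant_triples[OF 3] card cardVS False by linarith
      with ins[OF isolates_pendant_triples[OF 3]] show ?thesis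
        by (rule isolatesI_small)
    qed
  qed
qed

text \<open>The case in which the removed set is the whole graph: a single vertex isolates it, which
  is less than a third unless there are exactly three vertices.\<close>

lemma small_or_pendant_star:
  assumes pS: "p \<in> S" and card: "card S \<ge> 3"
    and triple: "card S = 3 \<Longrightarrow> \<exists>s t. S = {p, s, t} \<and> (p, s) \<in> E \<and> ((s, t) \<in> E \<or> (p, t) \<in> E)"
    and S: "\<And>u v. u \<in> S \<Longrightarrow> v \<in> S \<Longrightarrow> (u, v) \<in> E \<Longrightarrow> u \<in> dominated {p} \<or> v \<in> dominated {p}"
  shows "small_or_pendant S"
proof (cases "card S = 3")
  case True
  then obtain s t where st: "S = {p, s, t}" "(p, s) \<in> E" "(s, t) \<in> E \<or> (p, t) \<in> E"
    using triple by blast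
  moreover have "distinct [p, s, t]"
    using True st(1) card_distinct[of "[p, s, t]"] by simp
  ultimately show ?thesis
    using small_or_pendant_triple by blast
next
  case False
  have "isolates S {p}"
    using pS S by (auto simp: isolates_def)
  moreover have "3 * card {p} < card S"
    using card False by simp
  ultimately show ?thesis
    by (rule isolatesI_small)
qed

section \<open>Removing subtrees of a rooted tree\<close>

lemma sibling_treeD:
  assumes "sibling_tree V r par d"
  shows "finite V" "r \<in> V" "d r = 0"
    and "\<And>x. x \<in> V \<Longrightarrow> x \<noteq> r \<Longrightarrow> par x \<in> V \<and> (x, par x) \<in> E \<and> d x = Suc (d (par x))"
    and "\<And>x y. x \<in> V \<Longrightarrow> y \<in> V \<Longrightarrow> (x, y) \<in> E \<Longrightarrow>
      x \<noteq> r \<and> y = par x \<or> y \<noteq> r \<and> x = par y \<or> x \<noteq> r \<and> y \<noteq> r \<and> par x = par y"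
  using assms by (simp_all add: sibling_tree_def)

text \<open>If \<open>p\<close> is not the root, then \<open>r\<close> and \<open>par p\<close>
  survive, so \<open>V - S\<close> is again a sibling tree, and \<open>par p\<close> is the
  neighbour of \<open>p\<close> that the extension asks for.\<close>

lemma small_or_pendant_peel:
  assumes tree: "sibling_tree V r par d"
    and IH: "\<And>V'. card V' < card V \<Longrightarrow> sibling_tree V' r par d \<Longrightarrow> card V' = 2 \<or> small_or_pendant V'"
    and SV: "S \<subseteq> V" and pS: "p \<in> S" and card: "card S \<ge> 3"
    and triple: "card S = 3 \<Longrightarrow> \<exists>s t. S = {p, s, t} \<and> (p, s) \<in> E \<and> ((s, t) \<in> E \<or> (p, t) \<in> E)"
    and S: "\<And>u v. u \<in> S \<Longrightarrow> v \<in> S \<Longrightarrow> (u, v) \<in> E \<Longrightarrow> u \<in> dominated {p} \<or> v \<in> dominated {p}"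
    and VS: "\<And>u v. u \<in> V - S \<Longrightarrow> v \<in> S \<Longrightarrow> (u, v) \<in> E \<Longrightarrow> v = p"
    and closed: "\<And>x. x \<in> V \<Longrightarrow> x \<noteq> r \<Longrightarrow> par x \<in> S \<Longrightarrow> x \<in> S"
    and root: "p \<noteq> r \<Longrightarrow> r \<notin> S \<and> par p \<notin> S"
  shows "small_or_pendant V"
proof (cases "p = r")
  case True
  \<comment> \<open>\<open>S\<close> contains the root and is closed under children, so induction on
    the depth reaches every vertex.\<close>
  have "x \<in> S" if "x \<in> V" for x
    using that
  proof (induction "d x" arbitrary: x)
    case 0
    then have "x = r"
      using sibling_treeD(4)[OF tree] by fastforce
    then show ?case
      using pS True by simp
  next
    case (Suc n)
    then have x: "x \<noteq> r"
      using sibling_treeD(3)[OF tree] by auto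
    then have "par x \<in> V" "d x = Suc (d (par x))"
      using sibling_treeD(4)[OF tree] Suc.prems by blast+
    then show ?case
      using Suc x closed by auto
  qed
  then have "V = S"
    using SV by blast
  then show ?thesis
    using small_or_pendant_star[OF pS card triple S] by simp
next
  case False
  have fin: "finite V"
    using sibling_treeD(1)[OF tree] .
  have "sibling_tree (V - S) r par d"
    using tree closed root False by (auto simp: sibling_tree_def)
  moreover have "card (V - S) < card V"
    using fin SV pS by (intro psubset_card_mono) auto
  ultimately have V: "card (V - S) = 2 \<or> small_or_pendant (V - S)"
    using IH by blast
  have "p \<in> V"
    using pS SV by blast
  then have "par p \<in> V - S" "(p, par p) \<in> E"
    using sibling_treeD(4)[OF tree] False root by blast+
  then have "small_or_pendant ((V - S) \<union> S)"
    by (intro extend_small_or_pendant[OF _ _ _ V pS card triple S VS])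
      (use fin SV finite_subset in auto)
  then show ?thesis
    using SV by (simp add: Un_absorb2)
qed

text \<open>Two small trees are treated apart: the single root, which the empty set isolates, and a
  root with one child, which is the exception of order 2.\<close>

lemma sibling_tree_small_or_pendant:
  assumes "sibling_tree V r par d"
  shows "card V = 2 \<or> small_or_pendant V"
  using assms
proof (induction "card V" arbitrary: V rule: less_induct)
  case less
  note tree = less.prems
  note par = sibling_treeD(4)[OF tree]
  note edge = sibling_treeD(5)[OF tree]
  have fin: "finite V" and r: "r \<in> V" "d r = 0"
    using sibling_treeD[OF tree] by blast+
  define ch where "ch p = {x \<in> V. x \<noteq> r \<and> par x = p}" for p
  have chD: "x \<in> V" "x \<noteq> r" "par x = p" "p \<in> V" "(p, x) \<in> E" "d x = Suc (d p)" if "x \<in> ch p" for x p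
    using that par[of x] sym by (auto simp: ch_def)
  have finch: "finite (ch p)" for p
    using fin by (simp add: ch_def)
  define m where "m = Max (d ` V)"
  have m: "d x \<le> m" if "x \<in> V" for x
    using fin that by (simp add: m_def)
  have "m \<in> d ` V"
    unfolding m_def using fin r by (intro Max_in) auto
  then obtain v where v: "v \<in> V" "d v = m"
    by blast
  \<comment> \<open>A child would have depth \<open>m + 1\<close>.\<close>
  have leaf: "par y \<noteq> x" if "x \<in> V" "d x = m" "y \<in> V" "y \<noteq> r" for x y
    using par[OF that(3,4)] m[OF that(3)] that(2) by auto
  show ?case
  proof (cases "v = r")
    case True
    have "V = {r}"
      using par m v True r by fastforce
    then have "isolates V {}" "3 * card {} < card V"
      using irrefl by (auto simp: isolates_def)
    then show ?thesis
      using isolatesI_small by blast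
  next
    case False
    show ?thesis
    proof (cases "\<exists>w\<in>V. w \<noteq> r \<and> d w = m \<and> card (ch (par w)) \<ge> 2")
      case True
      then obtain w p where w: "w \<in> ch p" "d w = m" and card: "card (ch p) \<ge> 2"
        by (auto simp: ch_def)
      \<comment> \<open>All children of \<open>p\<close> have depth \<open>m\<close> and hence are
        leaves, so \<open>p\<close> and its children form a full subtree.\<close>
      have dp: "m = Suc (d p)"
        using chD[OF w(1)] w(2) by simp
      have p: "p \<notin> ch p"
        using chD(6) by fastforce
      have S: "card (insert p (ch p)) = Suc (card (ch p))"
        using p finch by simp
      have "small_or_pendant V"
      proof (rule small_or_pendant_peel[OF tree less.hyps, where S = "insert p (ch p)" and p = p])
        show "insert p (ch p) \<subseteq> V"
          using chD w by blast
        show "card (insert p (ch p)) \<ge> 3"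
          using S card by simp
        show "\<exists>s t. insert p (ch p) = {p, s, t} \<and> (p, s) \<in> E \<and> ((s, t) \<in> E \<or> (p, t) \<in> E)"
          if "card (insert p (ch p)) = 3"
        proof -
          have "card (ch p) = 2"
            using that S by simp
          then obtain s t where "ch p = {s, t}"
            by (auto simp: card_2_iff)
          then show ?thesis
            using chD(5) by blast
        qed
        show "x \<in> dominated {p} \<or> y \<in> dominated {p}" if "x \<in> insert p (ch p)" for x y
          using that chD(5) by (auto simp: dominated_def)
        show "y = p" if "x \<in> V - insert p (ch p)" "y \<in> insert p (ch p)" "(x, y) \<in> E" for x y
        proof (rule ccontr)
          assume "y \<noteq> p"
          with that have y: "y \<in> ch p"
            by simp
          then have "x \<noteq> r \<and> y = par x"
            using edge[of x y] chD[OF y] that by (auto simp: ch_def)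
          then show False
            using leaf[of y x] chD[OF y] dp that by auto
        qed
        show "x \<in> insert p (ch p)" if "x \<in> V" "x \<noteq> r" "par x \<in> insert p (ch p)" for x
        proof (cases "par x = p")
          case False
          then have "par x \<in> ch p"
            using that by simp
          then show ?thesis
            using leaf[of "par x" x] chD(1,6)[of "par x" p] dp that(1,2) by simp
        qed (use that in \<open>simp add: ch_def\<close>)
        show "r \<notin> insert p (ch p) \<and> par p \<notin> insert p (ch p)" if "p \<noteq> r"
        proof -
          have "d p = Suc (d (par p))"
            using par chD(4)[OF w(1)] that by blast
          then show ?thesis
            using that chD[of "par p" p] chD[of r p] by auto
        qed
      qed simp_all
      then show ?thesis ..
    next
      case nobranch: False
      have single: "ch (par w) = {w}" if "w \<in> V" "w \<noteq> r" "d w = m" for w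
      proof -
        have "w \<in> ch (par w)"
          using that by (simp add: ch_def)
        moreover have "card (ch (par w)) < 2"
          using nobranch that by (auto simp: not_le)
        ultimately show ?thesis
          using finch[of "par w"] card_le_Suc0_iff_eq[of "ch (par w)"] by force
      qed
      define p where "p = par v"
      have p: "p \<in> V" "(p, v) \<in> E" "m = Suc (d p)"
        using par[OF v(1) False] v(2) sym by (auto simp: p_def)
      have chp: "ch p = {v}"
        using single v False by (simp add: p_def)
      show ?thesis
      proof (cases "p = r")
        case True
        have "V = {r, v}"
        proof -
          have "x \<in> ch r" if x: "x \<in> V" "x \<noteq> r" for x
          proof -
            have "d (par x) = 0"
              using par[OF x] m[OF x(1)] p True r by simp
            then have "par x = r"
              using par[of "par x"] par[OF x] by force
            then show ?thesis
              using x by (simp add: ch_def)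
          qed
          then show ?thesis
            using True chp r v by blast
        qed
        then show ?thesis
          using False by simp
      next
        case pr: False
        define g where "g = par p"
        have g: "g \<in> V" "(g, p) \<in> E" "d p = Suc (d g)"
          using par[OF p(1) pr] sym by (auto simp: g_def)
        \<comment> \<open>These are all descendants of \<open>g\<close>, since its grandchildren
          already have depth \<open>m\<close>.\<close>
        define T where "T = insert g (ch g \<union> (\<Union>q\<in>ch g. ch q))"
        have pg: "p \<in> ch g"
          using p pr by (simp add: ch_def g_def)
        have d1: "d q = d p" if "q \<in> ch g" for q
          using chD(6)[OF that] g by simp
        have d2: "d x = m" if "q \<in> ch g" "x \<in> ch q" for q x
          using chD(6)[OF that(2)] d1[OF that(1)] p by simp
        have TV: "T \<subseteq> V"
          unfolding T_def using g chD(1) by blast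
        have sub: "{g, p, v} \<subseteq> T"
          unfolding T_def using pg chp by blast
        have c3: "card {g, p, v} = 3"
          using g(3) p(3) v(2) by (auto simp: card_insert_if)
        have finT: "finite T"
          using TV fin finite_subset by blast
        have "small_or_pendant V"
        proof (rule small_or_pendant_peel[OF tree less.hyps, where S = T and p = g])
          show "T \<subseteq> V" "g \<in> T"
            using TV by (auto simp: T_def)
          show "card T \<ge> 3"
            using card_mono[OF finT sub] c3 by simp
          show "\<exists>s t. T = {g, s, t} \<and> (g, s) \<in> E \<and> ((s, t) \<in> E \<or> (g, t) \<in> E)" if "card T = 3"
          proof -
            have "{g, p, v} = T"
              using card_subset_eq[OF finT sub] c3 that by simp
            then show ?thesis
              using g p by blast
          qed
          \<comment> \<open>An edge that avoids \<open>g\<close> and its children joins two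
            grandchildren. At depth \<open>m\<close> these would have to be siblings, which
            \<open>single\<close> excludes.\<close>
          show "x \<in> dominated {g} \<or> y \<in> dominated {g}" if xy: "x \<in> T" "y \<in> T" "(x, y) \<in> E" for x y
          proof (rule ccontr)
            assume "\<not> ?thesis"
            then have "x \<notin> insert g (ch g)" "y \<notin> insert g (ch g)"
              using chD(5) by (auto simp: dominated_def)
            then obtain q q' where q: "q \<in> ch g" "x \<in> ch q" "q' \<in> ch g" "y \<in> ch q'"
              using xy by (auto simp: T_def)
            have "x \<noteq> par y" "y \<noteq> par x"
              using leaf chD(1,2)[OF q(2)] chD(1,2)[OF q(4)] d2[OF q(1,2)] d2[OF q(3,4)] by blast+
            then have "par x = par y"
              using edge[of x y] that chD(1)[OF q(2)] chD(1)[OF q(4)] by blast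
            then have "y \<in> ch (par x)"
              using chD(1,2)[OF q(4)] by (simp add: ch_def)
            then have "y = x"
              using single[of x] chD(1,2)[OF q(2)] d2[OF q(1,2)] by blast
            then show False
              using that irrefl by blast
          qed
          have inT: "x \<in> T" if "x \<in> V" "x \<noteq> r" "par x \<in> T" for x
          proof -
            consider "par x = g" | "par x \<in> ch g" | q where "q \<in> ch g" "par x \<in> ch q"
              using \<open>par x \<in> T\<close> by (auto simp: T_def)
            then show ?thesis
            proof cases
              case 3
              then show ?thesis
                using leaf[of "par x" x] d2 chD(1) that by blast
            qed (use that in \<open>auto simp: T_def ch_def\<close>)
          qed
          then show "x \<in> T" if "x \<in> V" "x \<noteq> r" "par x \<in> T" for x
            using that .
          \<comment> \<open>A vertex of \<open>T\<close> other than \<open>g\<close> is adjacent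
            only to its parent, its siblings and its children, all of which lie in
            \<open>T\<close>.\<close>
          show "y = g" if xy: "x \<in> V - T" "y \<in> T" "(x, y) \<in> E" for x y
          proof (rule ccontr)
            assume "y \<noteq> g"
            then obtain q where q: "y \<in> ch q" "q \<in> insert g (ch g)"
              using xy by (auto simp: T_def)
            have qT: "q \<in> T" "ch q \<subseteq> T"
              using q(2) by (auto simp: T_def)
            have "\<not> (x \<noteq> r \<and> y = par x)"
              using inT xy by blast
            then have "x = q \<or> x \<in> ch q"
              using edge[of x y] xy chD[OF q(1)] by (auto simp: ch_def)
            then show False
              using xy qT by blast
          qed
          show "r \<notin> T \<and> par g \<notin> T" if "g \<noteq> r"
          proof -
            have "d g = Suc (d (par g))"
              using par g(1) that by blast
            moreover have "r \<notin> ch q" for q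
              by (simp add: ch_def)
            \<comment> \<open>This keeps \<open>par g\<close>, which has smaller depth, out of
              \<open>T\<close>.\<close>
            moreover have "d x \<ge> d g" if "x \<in> T" for x
              using that d1 d2 g p by (fastforce simp: T_def)
            ultimately show ?thesis
              using that by (fastforce simp: T_def)
          qed
        qed simp
        then show ?thesis ..
      qed
    qed
  qed
qed

end

section \<open>Block graphs\<close>

context adjacency
begin

section \<open>From cycles spanning cliques to a sibling tree\<close>

text \<open>Climb from both vertices until the parents coincide. The vertex below level
  \<open>n\<close> is the point: once the path is closed to a cycle through level
  \<open>n + 1\<close>, a clique on the cycle would contain a shortcut.\<close>

lemma path_at_level:
  assumes par: "\<And>x n. d x = Suc n \<Longrightarrow> x \<in> V \<Longrightarrow> par x \<in> V \<and> (x, par x) \<in> E \<and> d (par x) = n"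
    and root: "\<And>x. x \<in> V \<Longrightarrow> d x = 0 \<Longrightarrow> x = r"
    and "y \<in> V" "y' \<in> V" "d y = n" "d y' = n" "y \<noteq> y'"
  shows "\<exists>xs. distinct xs \<and> successively (\<lambda>x y. (x, y) \<in> E) xs \<and> xs \<noteq> [] \<and> hd xs = y \<and> last xs = y' \<and>
    length xs \<ge> 3 \<and> (\<forall>x\<in>set xs. x \<in> V \<and> d x \<le> n) \<and> (\<exists>x\<in>set xs. d x < n)"
  using assms(3-)
proof (induction n arbitrary: y y')
  case 0
  then show ?case
    using root by blast
next
  case (Suc n)
  note y = par[OF Suc.prems(3) Suc.prems(1)] and y' = par[OF Suc.prems(4) Suc.prems(2)]
  have par_y': "(par y', y') \<in> E"
    using y' sym by blast
  show ?case
  proof (cases "par y = par y'")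
    case True
    have ne: "par y \<noteq> y" "par y \<noteq> y'"
      using y Suc.prems(3,4) by auto
    show ?thesis
    proof (intro exI[of _ "[y, par y, y']"] conjI)
      show "successively (\<lambda>x y. (x, y) \<in> E) [y, par y, y']"
        using y par_y' True by simp
      show "\<forall>x\<in>set [y, par y, y']. x \<in> V \<and> d x \<le> Suc n" "\<exists>x\<in>set [y, par y, y']. d x < Suc n"
        using y Suc.prems(1-4) by simp_all
    qed (use ne Suc.prems(5) in auto)
  next
    case False
    then obtain xs where xs: "distinct xs" "successively (\<lambda>x y. (x, y) \<in> E) xs" "xs \<noteq> []"
      "hd xs = par y" "last xs = par y'" "length xs \<ge> 3" "\<forall>x\<in>set xs. x \<in> V \<and> d x \<le> n"
      using Suc.IH[of "par y" "par y'"] y y' by blast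
    have "\<exists>x\<in>set xs. d x < Suc n"
      using xs(3,7) by (meson hd_in_set less_Suc_eq_le)
    then show ?thesis
      using xs y y' par_y' Suc.prems
      by (intro exI[of _ "y # xs @ [y']"])
        (auto simp: successively_Cons successively_append_iff)
  qed
qed

text \<open>Take the distances from \<open>r\<close>. A second neighbour one level nearer to
  \<open>r\<close>, or an edge within a level between vertices with different parents, closes a path
  from \<open>path_at_level\<close> to a cycle, and the clique on it has an edge that skips a
  level.\<close>

lemma sibling_tree_of_cycle_cliques:
  assumes fin: "finite V" and r: "r \<in> V" and EV: "E \<subseteq> V \<times> V"
    and conn: "\<And>x. x \<in> V \<Longrightarrow> (r, x) \<in> E\<^sup>*"
    and clique: "\<And>xs x y. distinct xs \<Longrightarrow> xs \<noteq> [] \<Longrightarrow> successively (\<lambda>x y. (x, y) \<in> E) xs \<Longrightarrow> (last xs, hd xs) \<in> E \<Longrightarrow>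
      x \<in> set xs \<Longrightarrow> y \<in> set xs \<Longrightarrow> x \<noteq> y \<Longrightarrow> (x, y) \<in> E"
  shows "\<exists>par d. sibling_tree V r par d"
proof -
  define d where "d x = (LEAST n. (r, x) \<in> E ^^ n)" for x
  have walk: "(r, x) \<in> E ^^ d x" if "x \<in> V" for x
    unfolding d_def using conn[OF that] by (metis LeastI rtrancl_imp_relpow)
  have dle: "d x \<le> n" if "(r, x) \<in> E ^^ n" for x n
    unfolding d_def using that by (rule Least_le)
  have step: "d y \<le> Suc (d x)" if "(x, y) \<in> E" for x y
    using dle[of y "Suc (d x)"] walk[of x] that EV by auto
  have d0: "d r = 0"
    using dle[of r 0] by simp
  have root: "x = r" if "x \<in> V" "d x = 0" for x
    using walk[OF that(1)] that(2) by simp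
  have "\<exists>y. y \<in> V \<and> (x, y) \<in> E \<and> d y = n" if "d x = Suc n" "x \<in> V" for x n
  proof -
    have "(r, x) \<in> E ^^ Suc n"
      using walk[OF that(2)] that(1) by simp
    then obtain y where y: "(r, y) \<in> E ^^ n" "(y, x) \<in> E"
      by auto
    then have "d y \<le> n" "d x \<le> Suc (d y)"
      using dle step by blast+
    then show ?thesis
      using that(1) y(2) sym EV by auto
  qed
  then obtain par' where par': "par' x n \<in> V \<and> (x, par' x n) \<in> E \<and> d (par' x n) = n"
    if "d x = Suc n" "x \<in> V" for x n
    by metis
  \<comment> \<open>\<open>d x - 1\<close> is the level of the parent; the root, at level 0,
    receives an arbitrary value.\<close>
  define par where "par x = par' x (d x - 1)" for x
  have par: "par x \<in> V \<and> (x, par x) \<in> E \<and> d (par x) = n" if "d x = Suc n" "x \<in> V" for x n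
    using par'[OF that] that by (simp add: par_def)
  have up: "y = par x" if xy: "(x, y) \<in> E" "d x = Suc (d y)" for x y
  proof (rule ccontr)
    assume "y \<noteq> par x"
    have V: "x \<in> V" "y \<in> V"
      using xy EV by auto
    obtain xs where xs: "distinct xs" "successively (\<lambda>x y. (x, y) \<in> E) xs" "xs \<noteq> []"
      "hd xs = y" "last xs = par x" "\<forall>z\<in>set xs. z \<in> V \<and> d z \<le> d y" "\<exists>z\<in>set xs. d z < d y"
      using path_at_level[OF par root V(2) _ refl _ \<open>y \<noteq> par x\<close>] par[OF xy(2) V(1)] by blast
    obtain z where z: "z \<in> set xs" "d z < d y"
      using xs by blast
    have "x \<notin> set xs"
      using xs(6) xy(2) by auto
    \<comment> \<open>The cycle leaves \<open>x\<close> for \<open>y\<close>, follows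
      \<open>xs\<close> and returns from \<open>par x\<close>. Its clique joins \<open>x\<close> to
      \<open>z\<close>, which is at least two levels nearer to the root.\<close>
    then have "(z, x) \<in> E"
      using clique[of "x # xs" z x] xs z xy(1) sym[of x "par x"] par[OF xy(2) V(1)]
      by (auto simp: successively_Cons)
    then show False
      using step z xy(2) by fastforce
  qed
  have level: "par x = par y" if xy: "(x, y) \<in> E" "d x = Suc n" "d y = Suc n" for x y n
  proof (rule ccontr)
    assume ne: "par x \<noteq> par y"
    have V: "x \<in> V" "y \<in> V"
      using xy EV by auto
    obtain xs where xs: "distinct xs" "successively (\<lambda>x y. (x, y) \<in> E) xs" "xs \<noteq> []"
      "hd xs = par x" "last xs = par y" "\<forall>z\<in>set xs. z \<in> V \<and> d z \<le> n" "\<exists>z\<in>set xs. d z < n"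
      using path_at_level[OF par root _ _ _ _ ne, of n] par[OF xy(2) V(1)] par[OF xy(3) V(2)] by blast
    obtain z where z: "z \<in> set xs" "d z < n"
      using xs by blast
    have "x \<notin> set xs" "y \<notin> set xs" "x \<noteq> y"
      using xs(6) xy irrefl by auto
    \<comment> \<open>Here the edge between \<open>y\<close> and \<open>x\<close> closes the
      cycle.\<close>
    then have "(z, x) \<in> E"
      using clique[of "x # xs @ [y]" z x] xs z sym[OF xy(1)] sym[of y "par y"]
        par[OF xy(2) V(1)] par[OF xy(3) V(2)]
      by (auto simp: successively_Cons successively_append_iff)
    then show False
      using step z xy(2) by fastforce
  qed
  have "sibling_tree V r par d"
    unfolding sibling_tree_def
  proof (intro conjI ballI impI)
    fix x assume "x \<in> V - {r}"
    then obtain n where "x \<in> V" "d x = Suc n"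
      using root by (cases "d x") auto
    then show "par x \<in> V" "(x, par x) \<in> E" "d x = Suc (d (par x))"
      using par by auto
  next
    fix x y assume xy: "x \<in> V" "y \<in> V" "(x, y) \<in> E"
    have nr: "x \<noteq> r" if "d x = Suc n" for x n
      using that d0 by auto
    have "d x \<noteq> 0" if "d x = d y"
      using that root[OF xy(1)] root[OF xy(2)] xy(3) irrefl by metis
    then consider "d x = Suc (d y)" | "d y = Suc (d x)" | n where "d x = Suc n" "d y = Suc n"
      using step[OF xy(3)] step[OF sym[OF xy(3)]] by (metis le_SucE le_antisym not0_implies_Suc)
    then show "x \<noteq> r \<and> y = par x \<or> y \<noteq> r \<and> x = par y \<or> x \<noteq> r \<and> y \<noteq> r \<and> par x = par y"
    proof cases
      case 1
      then show ?thesis using up xy(3) nr by blast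
    next
      case 2
      then show ?thesis using up sym[OF xy(3)] nr by blast
    next
      case 3
      then show ?thesis using level[OF xy(3)] nr by blast
    qed
  qed (use fin r d0 in auto)
  then show ?thesis
    by blast
qed

end

section \<open>Blocks containing a cycle\<close>

text \<open>The head reaches every entry along the list; by symmetry every entry reaches the
  head.\<close>

lemma rtrancl_on_successively:
  assumes "sym R" "successively (\<lambda>x y. (x, y) \<in> R) xs" "set xs \<subseteq> F" "x \<in> set xs" "y \<in> set xs"
  shows "(x, y) \<in> rtrancl_on F R"
proof -
  have hd: "(hd xs, z) \<in> rtrancl_on F R" if "z \<in> set xs" for z
    using assms(2,3) that
  proof (induction xs)
    case (Cons a xs)
    show ?case
    proof (cases "z = a")
      case False
      then have "z \<in> set xs" "xs \<noteq> []"
        using Cons.prems by auto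
      then show ?thesis
        using Cons by (auto simp: successively_Cons intro: converse_rtrancl_on_into_rtrancl_on)
    qed (use Cons.prems in auto)
  qed simp
  have "(x, hd xs) \<in> rtrancl_on F R"
    using hd[OF assms(4)] rtrancl_on_sym[OF assms(1)] by (auto dest: symD)
  then show ?thesis
    using hd[OF assms(5)] by (rule rtrancl_on_trans)
qed

lemma connected_successively:
  assumes "verts H = set xs" "xs \<noteq> []" "successively (\<lambda>x y. x \<rightarrow>\<^bsub>H\<^esub> y) xs"
  shows "Digraph_Component.connected H"
proof -
  have "sym ((arcs_ends H)\<^sup>s)"
    by (auto simp: symcl_def sym_def)
  moreover have "successively (\<lambda>x y. (x, y) \<in> (arcs_ends H)\<^sup>s) xs"
    using assms(3) by (rule successively_mono) (auto simp: symcl_def)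
  ultimately show ?thesis
    unfolding connected_conv
    using rtrancl_on_successively[OF _ _ subset_refl, of "(arcs_ends H)\<^sup>s" xs] assms(1,2) by simp
qed

lemma arcs_ends_induce_subgraph: "arcs_ends (G \<restriction> W) = arcs_ends G \<inter> W \<times> W"
  by (auto simp: arcs_ends_conv)

lemma arcs_ends_del_vert:
  "arcs_ends (pre_digraph.del_vert G v) = {(x, y) \<in> arcs_ends G. x \<noteq> v \<and> y \<noteq> v}"
  by (auto simp: arcs_ends_conv pre_digraph.del_vert_def)

lemma (in graph) graph_induce_subgraph:
  assumes "W \<subseteq> verts G"
  shows "graph (G \<restriction> W)"
proof -
  have ind: "induced_subgraph (G \<restriction> W) G"
    using assms by (rule induced_induce)
  interpret H: digraph "G \<restriction> W"
    using ind by (rule digraphI_induced)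
  show ?thesis
    using induced_graph_imp_symmetric[OF sym_arcs ind] by (rule H.graphI)
qed

text \<open>Deleting \<open>v\<close> from the cycle \<open>as @ v # bs\<close> leaves the path
  \<open>bs @ as\<close>, joined by the arc from the last to the first vertex.\<close>

lemma cycle_no_cut_vertex:
  assumes H: "verts H = set xs" and xs: "distinct xs" "successively (\<lambda>x y. x \<rightarrow>\<^bsub>H\<^esub> y) xs"
    and closed: "last xs \<rightarrow>\<^bsub>H\<^esub> hd xs"
  shows "\<not> cut_vertex H v"
proof
  assume cut: "cut_vertex H v"
  then have "v \<in> set xs"
    using H by (simp add: cut_vertex_def)
  then obtain as bs where ab: "xs = as @ v # bs"
    by (auto simp: in_set_conv_decomp)
  have v: "v \<notin> set as" "v \<notin> set bs"
    using xs(1) ab by auto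
  have "successively (\<lambda>x y. x \<rightarrow>\<^bsub>H\<^esub> y) (bs @ as)"
    using xs(2) closed unfolding ab
    by (cases "bs = []"; cases "as = []") (auto simp: successively_append_iff successively_Cons)
  then have "successively (\<lambda>x y. x \<rightarrow>\<^bsub>pre_digraph.del_vert H v\<^esub> y) (bs @ as)"
    by (rule successively_mono) (use v in \<open>auto simp: arcs_ends_del_vert\<close>)
  moreover have "verts (pre_digraph.del_vert H v) = set (bs @ as)"
    using H v ab by (auto simp: pre_digraph.del_vert_def)
  ultimately have "Digraph_Component.connected (pre_digraph.del_vert H v)"
    using connected_successively[of _ "bs @ as"] cut by (auto simp: cut_vertex_def)
  then show False
    using cut by (simp add: cut_vertex_def)
qed

text \<open>Take a subgraph of maximal size among the connected ones without cut vertices that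
  contain \<open>H\<close>.\<close>

lemma (in graph) block_containing:
  assumes H: "subgraph H G" "graph H" "Digraph_Component.connected H" "\<And>v. \<not> cut_vertex H v"
  obtains B where "block G B" "subgraph H B"
proof -
  define P where "P K \<longleftrightarrow> subgraph H K \<and> subgraph K G \<and> graph K \<and>
    Digraph_Component.connected K \<and> (\<forall>v. \<not> cut_vertex K v)" for K
  \<comment> \<open>Arcs are counted along with vertices, since a larger subgraph may have the same
    vertices.\<close>
  define size where "size K = card (verts K) + card (arcs K)" for K :: "('a, 'b) pre_digraph"
  have bound: "size K < Suc (size G)" if "P K" for K
    using that card_mono[of "verts G" "verts K"] card_mono[of "arcs G" "arcs K"]
    by (auto simp: P_def size_def subgraph_def)
  have "P H"
    using H wf_digraph.subgraph_refl[of H] by (auto simp: P_def subgraph_def)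
  then obtain B where B: "P B" "\<And>K. P K \<Longrightarrow> size K \<le> size B"
    using ex_has_greatest_nat[of P H size "Suc (size G)"] bound by (metis less_imp_le)
  have "K = B" if K: "subgraph B K" "subgraph K G" "graph K" "Digraph_Component.connected K"
      "\<forall>v. \<not> cut_vertex K v" for K
  proof -
    have "P K"
      using K B(1) subgraph_trans unfolding P_def by blast
    then have "size K \<le> size B"
      by (rule B(2))
    moreover have sub: "verts B \<subseteq> verts K" "arcs B \<subseteq> arcs K" "compatible K B"
      using K(1) by auto
    moreover have fin: "finite (verts K)" "finite (arcs K)"
      using K(2) finite_subset[OF _ finite_verts] finite_subset[OF _ finite_arcs] by auto
    moreover have "card (verts B) \<le> card (verts K)" "card (arcs B) \<le> card (arcs K)"
      using fin sub by (auto intro: card_mono)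
    ultimately have "card (verts K) \<le> card (verts B)" "card (arcs K) \<le> card (arcs B)"
      unfolding size_def by linarith+
    with fin sub have "verts B = verts K" "arcs B = arcs K"
      using card_seteq by blast+
    \<comment> \<open>Compatibility identifies the tail and head functions, about which the two set
      equalities say nothing.\<close>
    with sub(3) show ?thesis
      by (auto simp: compatible_def)
  qed
  then have "block G B"
    unfolding block_def max_subgraph_def using B(1) by (auto simp: P_def)
  with B(1) that show thesis
    by (auto simp: P_def)
qed

text \<open>The subgraph induced by the cycle is connected and has no cut vertex, so it lies in a
  block, and that block is complete.\<close>

lemma block_graph_cycle_clique:
  assumes G: "block_graph G"
    and xs: "distinct xs" "xs \<noteq> []" "successively (\<lambda>x y. x \<rightarrow>\<^bsub>G\<^esub> y) xs" "last xs \<rightarrow>\<^bsub>G\<^esub> hd xs"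
    and xy: "x \<in> set xs" "y \<in> set xs" "x \<noteq> y"
  shows "x \<rightarrow>\<^bsub>G\<^esub> y"
proof -
  interpret graph G
    using G by (simp add: block_graph_def)
  let ?H = "G \<restriction> set xs"
  \<comment> \<open>Every entry has an arc to its successor, the last one to the head.\<close>
  have "set xs \<subseteq> verts G"
  proof
    fix z assume "z \<in> set xs"
    then obtain as bs where "xs = as @ z # bs"
      by (auto simp: in_set_conv_decomp)
    then show "z \<in> verts G"
      using xs(3,4) adj_in_verts by (cases bs) (auto simp: successively_append_iff successively_Cons)
  qed
  then have sub: "subgraph ?H G" "graph ?H"
    using induced_induce induced_imp_subgraph graph_induce_subgraph by blast+
  have succ: "successively (\<lambda>x y. x \<rightarrow>\<^bsub>?H\<^esub> y) xs"
    using xs(3) by (rule successively_mono) (auto simp: arcs_ends_induce_subgraph)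
  moreover have "last xs \<rightarrow>\<^bsub>?H\<^esub> hd xs"
    using xs by (auto simp: arcs_ends_induce_subgraph)
  ultimately obtain B where B: "block G B" "subgraph ?H B"
    using block_containing[OF sub connected_successively[OF _ xs(2) succ] cycle_no_cut_vertex[OF _ xs(1) succ]]
    by auto
  then obtain k where "complete_digraph k B"
    using G by (auto simp: block_graph_def)
  moreover have "x \<in> verts B" "y \<in> verts B"
    using subgraph_imp_subverts[OF B(2)] xy by auto
  ultimately have "x \<rightarrow>\<^bsub>B\<^esub> y"
    using xy(3) by (auto simp: complete_digraph_def)
  moreover have "subgraph B G"
    using B(1) by (auto simp: block_def max_subgraph_def)
  ultimately show ?thesis
    using arcs_ends_mono by blast
qed

lemma (in graph) adjacency_arcs_ends: "adjacency (arcs_ends G)"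
proof
  show "(y, x) \<in> arcs_ends G" if "(x, y) \<in> arcs_ends G" for x y
    using that by (rule graph_symmetric)
  show "(x, x) \<notin> arcs_ends G" for x
    using adj_not_same by blast
qed

text \<open>By symmetry, connectedness yields directed walks from any chosen root, as the distances
  require.\<close>

lemma block_graph_sibling_tree:
  assumes "block_graph G"
  shows "\<exists>r par d. adjacency.sibling_tree (arcs_ends G) (verts G) r par d"
proof -
  interpret graph G
    using assms by (simp add: block_graph_def)
  interpret adjacency "arcs_ends G"
    by (rule adjacency_arcs_ends)
  have sc: "strongly_connected G"
    using assms symmetric_connected_imp_strongly_connected sym_arcs by (simp add: block_graph_def)
  then obtain r where r: "r \<in> verts G"
    by (auto simp: strongly_connected_def)
  have "(r, x) \<in> (arcs_ends G)\<^sup>*" if "x \<in> verts G" for x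
    using sc r that by (intro reachable_rtranclI[where u = r and v = x]) (simp add: strongly_connected_def)
  then show ?thesis
    using sibling_tree_of_cycle_cliques[OF finite_verts r] block_graph_cycle_clique[OF assms] adj_in_verts
    by (smt (verit) mem_Sigma_iff subrelI)
qed

section \<open>Isolation numbers of the graphs in the family\<close>

text \<open>This form by edges holds for any \<open>pre_digraph\<close>, so it applies to
  \<open>attach\<close> as well as to graphs.\<close>

lemma isolating_set_iff:
  "isolating_set G D \<longleftrightarrow> D \<subseteq> verts G \<and>
     (\<forall>u\<in>verts G. \<forall>v\<in>verts G. u \<rightarrow>\<^bsub>G\<^esub> v \<longrightarrow>
        u \<in> D \<or> (\<exists>w\<in>D. u \<rightarrow>\<^bsub>G\<^esub> w) \<or> v \<in> D \<or> (\<exists>w\<in>D. v \<rightarrow>\<^bsub>G\<^esub> w))"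
proof -
  have "isolating_set G D \<longleftrightarrow> D \<subseteq> verts G \<and> (\<forall>u\<in>verts G. \<forall>v\<in>verts G. u \<rightarrow>\<^bsub>G\<^esub> v \<longrightarrow>
      u \<in> closed_neighborhood G D \<or> v \<in> closed_neighborhood G D)"
    by (auto simp: isolating_set_def independent_set_def)
  also have "\<dots> \<longleftrightarrow> D \<subseteq> verts G \<and>
     (\<forall>u\<in>verts G. \<forall>v\<in>verts G. u \<rightarrow>\<^bsub>G\<^esub> v \<longrightarrow>
        u \<in> D \<or> (\<exists>w\<in>D. u \<rightarrow>\<^bsub>G\<^esub> w) \<or> v \<in> D \<or> (\<exists>w\<in>D. v \<rightarrow>\<^bsub>G\<^esub> w))"
    by (intro conj_cong ball_cong refl) (simp add: closed_neighborhood_def disj_assoc)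
  finally show ?thesis .
qed

lemma (in graph) isolating_set_iff_isolates:
  "isolating_set G D \<longleftrightarrow> adjacency.isolates (arcs_ends G) (verts G) D"
proof -
  interpret adjacency "arcs_ends G"
    by (rule adjacency_arcs_ends)
  have "(\<exists>w\<in>D. u \<rightarrow>\<^bsub>G\<^esub> w) \<longleftrightarrow> u \<in> arcs_ends G `` D" for u
    using sym by blast
  then show ?thesis
    by (simp add: isolating_set_iff isolates_def dominated_def disj_assoc)
qed

lemma finite_isolating_sets: "finite (verts G) \<Longrightarrow> finite {D. isolating_set G D}"
  by (rule finite_subset[of _ "Pow (verts G)"]) (auto simp: isolating_set_def)

lemma isolation_number_le:
  assumes "finite (verts G)" "isolating_set G D"
  shows "isolation_number G \<le> card D"
  unfolding isolation_number_def using finite_isolating_sets[OF assms(1)] assms(2)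
  by (intro Min_le) auto

lemma isolation_number_eqI:
  assumes "finite (verts G)" "isolating_set G D" "\<And>D'. isolating_set G D' \<Longrightarrow> card D \<le> card D'"
  shows "isolation_number G = card D"
  unfolding isolation_number_def using finite_isolating_sets[OF assms(1)] assms(2,3)
  by (intro Min_eqI) auto

text \<open>Isolation depends on adjacency only, so just the vertex map of the isomorphism is
  kept.\<close>

lemma (in wf_digraph) digraph_iso_bij_betw:
  assumes "digraph_iso G H"
  obtains f where "bij_betw f (verts G) (verts H)"
    "\<And>u v. u \<in> verts G \<Longrightarrow> v \<in> verts G \<Longrightarrow> f u \<rightarrow>\<^bsub>H\<^esub> f v \<longleftrightarrow> u \<rightarrow> v"
proof -
  obtain hom where hom: "digraph_isomorphism hom" "H = app_iso hom G"
    using assms by (auto simp: digraph_iso_def)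
  have inj: "inj_on (iso_verts hom) (verts G)"
    using hom(1) by (rule digraph_isomorphism_inj_on_verts)
  show thesis
  proof
    show "bij_betw (iso_verts hom) (verts G) (verts H)"
      using inj hom(2) by (simp add: bij_betw_def)
    fix u v assume uv: "u \<in> verts G" "v \<in> verts G"
    have "u \<rightarrow> v" if xy: "x \<rightarrow> y" "iso_verts hom x = iso_verts hom u" "iso_verts hom y = iso_verts hom v" for x y
      using inj_onD[OF inj xy(2)] inj_onD[OF inj xy(3)] adj_in_verts[OF xy(1)] uv xy(1) by simp
    then show "iso_verts hom u \<rightarrow>\<^bsub>H\<^esub> iso_verts hom v \<longleftrightarrow> u \<rightarrow> v"
      unfolding hom(2) arcs_ends_app_iso_eq[OF hom(1)] by force
  qed
qed

text \<open>Images under the vertex bijection match the isolating sets of both graphs and preserve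
  cardinalities.\<close>

lemma (in wf_digraph) isolation_number_digraph_iso:
  assumes "digraph_iso G H"
  shows "isolation_number G = isolation_number H"
proof -
  obtain f where f: "bij_betw f (verts G) (verts H)"
    "\<And>u v. u \<in> verts G \<Longrightarrow> v \<in> verts G \<Longrightarrow> f u \<rightarrow>\<^bsub>H\<^esub> f v \<longleftrightarrow> u \<rightarrow> v"
    using digraph_iso_bij_betw[OF assms] by blast
  have inj: "inj_on f (verts G)" and H: "verts H = f ` verts G"
    using f(1) by (auto simp: bij_betw_def)
  have iso: "isolating_set H (f ` D) \<longleftrightarrow> isolating_set G D" if D: "D \<subseteq> verts G" for D
  proof -
    have mem: "f u \<in> f ` D \<longleftrightarrow> u \<in> D" if "u \<in> verts G" for u
      using inj_on_image_mem_iff[OF inj that D] .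
    have nb: "(\<exists>w\<in>f ` D. f u \<rightarrow>\<^bsub>H\<^esub> w) \<longleftrightarrow> (\<exists>w\<in>D. u \<rightarrow> w)" if "u \<in> verts G" for u
      using D f(2)[OF that] by auto
    \<comment> \<open>\<open>R\<close> abbreviates the edge condition in \<open>H\<close>, so that
      the quantifiers over the image can be pulled back to \<open>verts G\<close> before it is
      unfolded.\<close>
    define R where "R u v \<longleftrightarrow> (u \<rightarrow>\<^bsub>H\<^esub> v \<longrightarrow>
      u \<in> f ` D \<or> (\<exists>w\<in>f ` D. u \<rightarrow>\<^bsub>H\<^esub> w) \<or> v \<in> f ` D \<or> (\<exists>w\<in>f ` D. v \<rightarrow>\<^bsub>H\<^esub> w))" for u v
    have "isolating_set H (f ` D) \<longleftrightarrow> f ` D \<subseteq> f ` verts G \<and> (\<forall>u\<in>f ` verts G. \<forall>v\<in>f ` verts G. R u v)"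
      unfolding isolating_set_iff H R_def ..
    also have "\<dots> \<longleftrightarrow> (\<forall>u\<in>verts G. \<forall>v\<in>verts G. R (f u) (f v))"
      using D by blast
    also have "\<dots> \<longleftrightarrow> isolating_set G D"
      unfolding isolating_set_iff R_def using D mem nb f(2) by simp
    finally show ?thesis .
  qed
  have ex: "\<exists>D. isolating_set G D \<and> D' = f ` D" if "isolating_set H D'" for D'
  proof -
    have "D' \<subseteq> f ` verts G"
      using that H by (simp add: isolating_set_iff)
    then obtain D where "D \<subseteq> verts G" "D' = f ` D"
      by (auto simp: subset_image_iff)
    then show ?thesis
      using that iso by blast
  qed
  have sub: "D \<subseteq> verts G" if "isolating_set G D" for D
    using that by (simp add: isolating_set_def)
  have "{D. isolating_set H D} = (`) f ` {D. isolating_set G D}"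
  proof (intro equalityI subsetI)
    fix D' assume "D' \<in> {D. isolating_set H D}"
    then obtain D where "isolating_set G D" "D' = f ` D"
      using ex by blast
    then show "D' \<in> (`) f ` {D. isolating_set G D}"
      by simp
  next
    fix D' assume "D' \<in> (`) f ` {D. isolating_set G D}"
    then obtain D where "isolating_set G D" "D' = f ` D"
      by blast
    then show "D' \<in> {D. isolating_set H D}"
      using iso[OF sub] by simp
  qed
  moreover have "(\<lambda>D. card (f ` D)) ` {D. isolating_set G D} = card ` {D. isolating_set G D}"
    using inj_on_subset[OF inj sub] by (intro image_cong) (auto intro: card_image)
  ultimately have "card ` {D. isolating_set H D} = card ` {D. isolating_set G D}"
    by (simp add: image_image)
  then show ?thesis
    by (simp add: isolation_number_def)
qed

section \<open>Attachable graphs\<close>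

lemma attachable_simps:
  "pverts P3 = {0, 1, 2}" "parcs P3 = {(0,1), (1,2), (1,0), (2,1)}"
  "pverts C3 = {0, 1, 2}" "parcs C3 = {(0,1), (1,2), (2,0), (1,0), (2,1), (0,2)}"
  by (auto simp: P3_def C3_def graph_of_edges_def)

text \<open>The four graphs of order 6 differ only in the set \<open>N\<close> of cycle vertices
  adjacent to the circled one, and both bounds on isolating sets can be had from the two stated
  conditions on \<open>N\<close>.\<close>

lemma attachable_cases:
  assumes "X \<in> attachable"
  obtains (P3) "X = P3" | (C3) "X = C3"
  | (H6) N where "1 \<in> N" "N \<subseteq> {1, 2, 3}" "pverts X = {..<6}"
      "parcs X = C5_edges \<union> C5_edges\<inverse> \<union> {0} \<times> N \<union> N \<times> {0}"
proof -
  have parcs: "parcs (graph_of_edges 6 (C5_edges \<union> {0} \<times> N)) = C5_edges \<union> C5_edges\<inverse> \<union> {0} \<times> N \<union> N \<times> {0}"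
    and pverts: "pverts (graph_of_edges 6 (C5_edges \<union> {0} \<times> N)) = {..<6}" for N
    by (auto simp: graph_of_edges_def)
  have "H6_1 = graph_of_edges 6 (C5_edges \<union> {0} \<times> {1})"
    "H6_2a = graph_of_edges 6 (C5_edges \<union> {0} \<times> {1, 2})"
    "H6_2b = graph_of_edges 6 (C5_edges \<union> {0} \<times> {1, 3})"
    "H6_3 = graph_of_edges 6 (C5_edges \<union> {0} \<times> {1, 2, 3})"
    by (simp_all add: H6_1_def H6_2a_def H6_2b_def H6_3_def)
  then consider "X = P3" | "X = C3" | "X = graph_of_edges 6 (C5_edges \<union> {0} \<times> {1})"
    | "X = graph_of_edges 6 (C5_edges \<union> {0} \<times> {1, 2})"
    | "X = graph_of_edges 6 (C5_edges \<union> {0} \<times> {1, 3})"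
    | "X = graph_of_edges 6 (C5_edges \<union> {0} \<times> {1, 2, 3})"
    using assms unfolding attachable_def by auto
  then show thesis
  proof cases
    case 3
    show thesis
      by (rule that(3)[of "{1}"]) (simp_all only: 3 parcs pverts, simp_all)
  next
    case 4
    show thesis
      by (rule that(3)[of "{1, 2}"]) (simp_all only: 4 parcs pverts, simp_all)
  next
    case 5
    show thesis
      by (rule that(3)[of "{1, 3}"]) (simp_all only: 5 parcs pverts, simp_all)
  next
    case 6
    show thesis
      by (rule that(3)[of "{1, 2, 3}"]) (simp_all only: 6 parcs pverts, simp_all)
  qed (use that in blast)+
qed

text \<open>An isolating set of a third of the order. It contains the circled vertex, so that the
  union over all copies also meets every edge of \<open>G\<^sub>0\<close>.\<close>

definition hub :: "nat pair_pre_digraph \<Rightarrow> nat set" where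
  "hub X = (if card (pverts X) = 3 then {0} else {0, 4})"

lemma attachable_hub:
  assumes "X \<in> attachable"
  shows "finite (pverts X)" "0 \<in> hub X" "hub X \<subseteq> pverts X" "card (pverts X) = 3 * card (hub X)"
    "parcs X \<subseteq> pverts X \<times> pverts X"
    and "(i, j) \<in> parcs X \<Longrightarrow> i \<in> hub X \<or> (\<exists>k\<in>hub X. (i, k) \<in> parcs X) \<or> j \<in> hub X \<or> (\<exists>k\<in>hub X. (j, k) \<in> parcs X)"
proof -
  have "finite (pverts X) \<and> 0 \<in> hub X \<and> hub X \<subseteq> pverts X \<and> card (pverts X) = 3 * card (hub X) \<and>
    parcs X \<subseteq> pverts X \<times> pverts X \<and>
    (\<forall>(i, j)\<in>parcs X. i \<in> hub X \<or> (\<exists>k\<in>hub X. (i, k) \<in> parcs X) \<or> j \<in> hub X \<or> (\<exists>k\<in>hub X. (j, k) \<in> parcs X))"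
    using assms
  proof (cases rule: attachable_cases)
    case (H6 N)
    have hub: "hub X = {0, 4}"
      using H6 by (simp add: hub_def)
    have sub: "parcs X \<subseteq> pverts X \<times> pverts X"
      using H6 by (auto simp: C5_edges_def)
    have arcs: "(1, 0) \<in> parcs X" "(3, 4) \<in> parcs X" "(5, 4) \<in> parcs X" "(2, 2) \<notin> parcs X"
      using H6 by (auto simp: C5_edges_def)
    \<comment> \<open>\<open>0\<close> dominates 1 and \<open>4\<close> dominates 3 and 5, so only
      vertex 2 can be left.\<close>
    have two: "k = 2" if "k \<in> pverts X" "k \<notin> hub X" "\<forall>l\<in>hub X. (k, l) \<notin> parcs X" for k
    proof -
      have "k \<in> {0, 1, 2, 3, 4, 5}"
        using that(1) H6 by auto
      then show ?thesis
        using that(2,3) hub arcs by auto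
    qed
    have "i \<in> hub X \<or> (\<exists>k\<in>hub X. (i, k) \<in> parcs X) \<or> j \<in> hub X \<or> (\<exists>k\<in>hub X. (j, k) \<in> parcs X)"
      if "(i, j) \<in> parcs X" for i j
      using two[of i] two[of j] that sub arcs(4) by blast
    moreover have "card (pverts X) = 3 * card (hub X)"
      using H6 hub by simp
    ultimately show ?thesis
      using H6(3) hub sub by auto
  qed (auto simp: hub_def attachable_simps)
  then show "finite (pverts X)" "0 \<in> hub X" "hub X \<subseteq> pverts X" "card (pverts X) = 3 * card (hub X)"
    "parcs X \<subseteq> pverts X \<times> pverts X"
    "(i, j) \<in> parcs X \<Longrightarrow> i \<in> hub X \<or> (\<exists>k\<in>hub X. (i, k) \<in> parcs X) \<or> j \<in> hub X \<or> (\<exists>k\<in>hub X. (j, k) \<in> parcs X)"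
    by blast+
qed

text \<open>Only the edges avoiding the circled vertex are required to be hit, since that vertex may be
  dominated from outside the copy.\<close>

lemma attachable_lower_bound:
  assumes X: "X \<in> attachable" and I: "I \<subseteq> pverts X"
    and dom: "\<And>i j. (i, j) \<in> parcs X \<Longrightarrow> i \<noteq> 0 \<Longrightarrow> j \<noteq> 0 \<Longrightarrow>
      i \<in> I \<or> (\<exists>k\<in>I. (i, k) \<in> parcs X) \<or> j \<in> I \<or> (\<exists>k\<in>I. (j, k) \<in> parcs X)"
  shows "card (pverts X) \<le> 3 * card I"
proof -
  have fin: "finite I"
    using attachable_hub(1)[OF X] I finite_subset by blast
  show ?thesis
    using X
  proof (cases rule: attachable_cases)
    case (H6 N)
    have "card I \<ge> 2"
    proof (rule ccontr)
      assume "\<not> card I \<ge> 2"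
      then have "card I = 0 \<or> card I = 1"
        by linarith
      \<comment> \<open>The empty set is covered by any choice of \<open>k\<close>.\<close>
      then obtain k where k: "I \<subseteq> {k}" "k \<in> {0, 1, 2, 3, 4, 5}"
      proof
        assume "card I = 1"
        then obtain k where "I = {k}"
          by (auto simp: card_1_singleton_iff)
        moreover from this have "k < 6"
          using I H6(3) by auto
        then have "k \<in> {0, 1, 2, 3, 4, 5}"
          by auto
        ultimately show thesis
          using that by blast
      qed (use fin that in auto)
      have C5: "i \<in> {k} \<or> (i, k) \<in> parcs X \<or> j \<in> {k} \<or> (j, k) \<in> parcs X" if "(i, j) \<in> C5_edges" for i j
      proof -
        have "(i, j) \<in> parcs X" "i \<noteq> 0" "j \<noteq> 0"
          using that H6(4) by (auto simp: C5_edges_def)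
        then show ?thesis
          using dom[of i j] k(1) by blast
      qed
      have no: "0 \<notin> N" "4 \<notin> N" "5 \<notin> N"
        using H6(2) by auto
      \<comment> \<open>A cycle vertex \<open>k\<close> misses the cycle edge opposite to it. The
        circled vertex has its neighbours among 1, 2, 3, so it misses the edge between 4 and
        5.\<close>
      from k(2) consider "k = 0" | "k = 1" | "k = 2" | "k = 3" | "k = 4" | "k = 5"
        by blast
      then show False
      proof cases
        case 1
        then show ?thesis using C5[of 4 5] no H6(4) by (simp add: C5_edges_def)
      next
        case 2
        then show ?thesis using C5[of 3 4] no H6(4) by (simp add: C5_edges_def)
      next
        case 3
        then show ?thesis using C5[of 4 5] no H6(4) by (simp add: C5_edges_def)
      next
        case 4
        then show ?thesis using C5[of 5 1] no H6(4) by (simp add: C5_edges_def)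
      next
        case 5
        then show ?thesis using C5[of 1 2] no H6(4) by (simp add: C5_edges_def)
      next
        case 6
        then show ?thesis using C5[of 2 3] no H6(4) by (simp add: C5_edges_def)
      qed
    qed
    then show ?thesis
      using H6 by simp
  next
    case P3
    \<comment> \<open>The edge between 1 and 2 avoids the circled vertex, so it must be hit from
      inside the copy.\<close>
    then have "I \<noteq> {}"
      using dom[of 1 2] by (auto simp: attachable_simps)
    then have "card I > 0"
      using fin by (simp add: card_gt_0_iff)
    then show ?thesis
      using P3 by (simp add: attachable_simps)
  next
    case C3
    then have "I \<noteq> {}"
      using dom[of 1 2] by (auto simp: attachable_simps)
    then have "card I > 0"
      using fin by (simp add: card_gt_0_iff)
    then show ?thesis
      using C3 by (simp add: attachable_simps)
  qed
qed

section \<open>Isolation numbers of attachments\<close>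

lemma attach_arc:
  "((u, i), (v, j)) \<in> parcs (attach G\<^sub>0 A) \<longleftrightarrow>
     u = v \<and> u \<in> verts G\<^sub>0 \<and> (i, j) \<in> parcs (A u) \<or> i = 0 \<and> j = 0 \<and> u \<rightarrow>\<^bsub>G\<^sub>0\<^esub> v"
  by (auto simp: attach_def)

text \<open>The union of the hubs attains a third of the order. Conversely, vertices that are not
  circled have neighbours only in their own copy, so each slice of an isolating set obeys the lower
  bound for its copy.\<close>

lemma isolation_number_attach:
  fixes G\<^sub>0 :: "('a, 'b) pre_digraph"
  assumes fin: "finite (verts G\<^sub>0)" and A: "\<And>v. v \<in> verts G\<^sub>0 \<Longrightarrow> A v \<in> attachable"
  shows "card (pverts (attach G\<^sub>0 A)) = 3 * isolation_number (with_proj (attach G\<^sub>0 A))"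
proof -
  let ?H = "attach G\<^sub>0 A"
  let ?D = "SIGMA v:verts G\<^sub>0. hub (A v)"
  have V: "pverts ?H = (SIGMA v:verts G\<^sub>0. pverts (A v))"
    by (simp add: attach_def)
  have finH: "finite (pverts ?H)"
    unfolding V using fin attachable_hub(1)[OF A] by blast
  have cardH: "card (pverts ?H) = (\<Sum>v\<in>verts G\<^sub>0. card (pverts (A v)))"
    unfolding V using fin attachable_hub(1)[OF A] by (intro card_SigmaI) auto
  have "card ?D = (\<Sum>v\<in>verts G\<^sub>0. card (hub (A v)))"
    using fin by (intro card_SigmaI) (auto simp: hub_def)
  then have cardD: "3 * card ?D = card (pverts ?H)"
    using cardH attachable_hub(4)[OF A] by (simp add: sum_distrib_left)
  have "isolating_set (with_proj ?H) ?D"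
    unfolding isolating_set_iff
  proof (intro conjI ballI impI)
    show "?D \<subseteq> verts (with_proj ?H)"
      using attachable_hub(3)[OF A] by (auto simp: V)
    fix x y
    assume xy: "x \<in> verts (with_proj ?H)" "y \<in> verts (with_proj ?H)" "x \<rightarrow>\<^bsub>with_proj ?H\<^esub> y"
    obtain u i v j where x: "x = (u, i)" and y: "y = (v, j)"
      by (cases x; cases y)
    have u: "u \<in> verts G\<^sub>0"
      using xy(1) x V by simp
    \<comment> \<open>An arc lies in one copy or joins circled vertices; in the second case its tail
      belongs to a hub.\<close>
    from xy(3) consider "u = v" "(i, j) \<in> parcs (A u)" | "i = 0"
      unfolding x y by (auto simp: attach_arc)
    then show "x \<in> ?D \<or> (\<exists>w\<in>?D. x \<rightarrow>\<^bsub>with_proj ?H\<^esub> w) \<or> y \<in> ?D \<or> (\<exists>w\<in>?D. y \<rightarrow>\<^bsub>with_proj ?H\<^esub> w)"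
    proof cases
      case 1
      have arc: "\<exists>w\<in>?D. (u, l) \<rightarrow>\<^bsub>with_proj ?H\<^esub> w" if "k \<in> hub (A u)" "(l, k) \<in> parcs (A u)" for k l
        using that u by (intro bexI[of _ "(u, k)"]) (auto simp: attach_arc)
      show ?thesis
        using attachable_hub(6)[OF A[OF u] 1(2)] arc u 1(1) unfolding x y by blast
    next
      case 2
      then show ?thesis
        using attachable_hub(2)[OF A[OF u]] u by (simp add: x)
    qed
  qed
  moreover have "card ?D \<le> card D" if "isolating_set (with_proj ?H) D" for D
  proof -
    define I where "I v = {i. (v, i) \<in> D}" for v
    have D: "D \<subseteq> pverts ?H"
      using that by (simp add: isolating_set_iff)
    have I: "I v \<subseteq> pverts (A v)" for v
      using D by (auto simp: I_def V)
    have DI: "D = (SIGMA v:verts G\<^sub>0. I v)"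
      using D by (auto simp: I_def V)
    have "card (pverts (A v)) \<le> 3 * card (I v)" if v: "v \<in> verts G\<^sub>0" for v
    proof (rule attachable_lower_bound[OF A[OF v] I])
      fix i j assume ij: "(i, j) \<in> parcs (A v)" "i \<noteq> 0" "j \<noteq> 0"
      have "i \<in> pverts (A v)" "j \<in> pverts (A v)"
        using attachable_hub(5)[OF A[OF v]] ij(1) by auto
      then have "(v, i) \<in> D \<or> (\<exists>w\<in>D. ((v, i), w) \<in> parcs ?H) \<or> (v, j) \<in> D \<or> (\<exists>w\<in>D. ((v, j), w) \<in> parcs ?H)"
        using \<open>isolating_set _ D\<close> v ij unfolding isolating_set_iff by (auto simp: V attach_arc)
      \<comment> \<open>As \<open>l\<close> is not circled, its neighbours in the attachment lie in
        the copy at \<open>v\<close>.\<close>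
      moreover have "\<exists>k\<in>I v. (l, k) \<in> parcs (A v)" if "w \<in> D" "((v, l), w) \<in> parcs ?H" "l \<noteq> 0" for w l
        using that by (cases w) (auto simp: I_def attach_arc)
      ultimately show "i \<in> I v \<or> (\<exists>k\<in>I v. (i, k) \<in> parcs (A v)) \<or> j \<in> I v \<or> (\<exists>k\<in>I v. (j, k) \<in> parcs (A v))"
        using ij unfolding I_def by blast
    qed
    then have "card (pverts ?H) \<le> 3 * (\<Sum>v\<in>verts G\<^sub>0. card (I v))"
      unfolding cardH sum_distrib_left by (rule sum_mono)
    also have "(\<Sum>v\<in>verts G\<^sub>0. card (I v)) = card D"
      unfolding DI using fin finite_subset[OF I attachable_hub(1)[OF A]]
      by (intro card_SigmaI[symmetric]) auto
    finally show ?thesis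
      using cardD by simp
  qed
  ultimately have "isolation_number (with_proj ?H) = card ?D"
    using finH by (intro isolation_number_eqI) auto
  then show ?thesis
    using cardD by simp
qed

lemma isolation_number_family_G:
  fixes G :: "('a, 'b) pre_digraph"
  assumes "G \<in> family_G" "wf_digraph G"
  shows "card (verts G) = 3 * isolation_number G"
proof -
  interpret wf_digraph G
    by fact
  from assms(1) obtain G\<^sub>0 :: "'a pair_pre_digraph" and A where
    G\<^sub>0: "pair_graph G\<^sub>0" and A: "\<And>v. v \<in> pverts G\<^sub>0 \<Longrightarrow> A v \<in> attachable"
    and iso: "digraph_iso G (with_proj (attach (with_proj G\<^sub>0) A))"
    by (auto simp: family_G_def)
  interpret G\<^sub>0: pair_graph G\<^sub>0
    by fact
  obtain f where "bij_betw f (verts G) (verts (with_proj (attach (with_proj G\<^sub>0) A)))"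
    using digraph_iso_bij_betw[OF iso] by blast
  then have "card (verts G) = card (verts (with_proj (attach (with_proj G\<^sub>0) A)))"
    by (rule bij_betw_same_card)
  then have "card (verts G) = card (pverts (attach (with_proj G\<^sub>0) A))"
    by simp
  also have "\<dots> = 3 * isolation_number (with_proj (attach (with_proj G\<^sub>0) A))"
    using A by (intro isolation_number_attach) (auto simp: G\<^sub>0.pair_finite_verts)
  finally show ?thesis
    by (simp add: isolation_number_digraph_iso[OF iso])
qed

section \<open>From pendant triples to the family\<close>

text \<open>Arcs of \<open>with_proj H\<close> are pairs, so an arc of \<open>G\<close> is sent to
  the pair of images of its ends; this map is injective because \<open>G\<close> has no parallel
  arcs.\<close>

lemma (in graph) digraph_iso_with_projI:
  assumes bij: "bij_betw f (pverts H) (verts G)" and H: "parcs H \<subseteq> pverts H \<times> pverts H"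
    and arc: "\<And>p q. p \<in> pverts H \<Longrightarrow> q \<in> pverts H \<Longrightarrow> (p, q) \<in> parcs H \<longleftrightarrow> f p \<rightarrow> f q"
  shows "digraph_iso G (with_proj H)"
proof -
  define g where "g = the_inv_into (pverts H) f"
  define hom where "hom = \<lparr>iso_verts = g, iso_arcs = \<lambda>e. (g (tail G e), g (head G e)),
    iso_head = snd, iso_tail = fst\<rparr>"
  have inj: "inj_on f (pverts H)" and V: "verts G = f ` pverts H"
    using bij by (auto simp: bij_betw_def)
  have g: "bij_betw g (verts G) (pverts H)"
    unfolding g_def using bij by (rule bij_betw_the_inv_into)
  have gf: "g (f p) = p" if "p \<in> pverts H" for p
    unfolding g_def using inj that by (rule the_inv_into_f_f)
  have fg: "f (g x) = x" if "x \<in> verts G" for x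
    using that gf V by auto
  have "digraph_isomorphism hom"
    unfolding digraph_isomorphism_def
  proof (intro conjI ballI)
    show "wf_digraph G" ..
    show "inj_on (iso_verts hom) (verts G)"
      using g by (simp add: hom_def bij_betw_def)
    show "inj_on (iso_arcs hom) (arcs G)"
    proof (rule inj_onI)
      fix e e' assume e: "e \<in> arcs G" "e' \<in> arcs G" "iso_arcs hom e = iso_arcs hom e'"
      then have "tail G e = tail G e'" "head G e = head G e'"
        using g by (auto simp: hom_def bij_betw_def dest: inj_onD)
      then show "e = e'"
        using e no_multi_arcs by (simp add: arc_to_ends_def)
    qed
  qed (simp_all add: hom_def)
  moreover have "with_proj H = app_iso hom G"
  proof -
    have "parcs H = (\<lambda>e. (g (tail G e), g (head G e))) ` arcs G"
    proof (intro equalityI subsetI)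
      fix pq assume pq: "pq \<in> parcs H"
      then obtain p q where pq': "pq = (p, q)" "p \<in> pverts H" "q \<in> pverts H"
        using H by auto
      then obtain e where "e \<in> arcs G" "tail G e = f p" "head G e = f q"
        using arc pq by blast
      then show "pq \<in> (\<lambda>e. (g (tail G e), g (head G e))) ` arcs G"
        using gf pq' by force
    next
      fix pq assume "pq \<in> (\<lambda>e. (g (tail G e), g (head G e))) ` arcs G"
      then obtain e where e: "e \<in> arcs G" "pq = (g (tail G e), g (head G e))"
        by blast
      have "tail G e \<rightarrow> head G e"
        using e(1) by (auto simp: arcs_ends_conv)
      then show "pq \<in> parcs H"
        using arc[of "g (tail G e)" "g (head G e)"] fg e(2) g tail_in_verts[OF e(1)] head_in_verts[OF e(1)]
        by (auto simp: bij_betw_def)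
    qed
    then show ?thesis
      using g by (simp add: with_proj_def app_iso_def hom_def bij_betw_def)
  qed
  ultimately show ?thesis
    by (auto simp: digraph_iso_def)
qed

text \<open>\<open>G\<^sub>0\<close> is induced by the circled vertices, and \<open>f\<close> sends
  the vertices 0, 1, 2 of the copy at \<open>c\<close> to \<open>c\<close>, \<open>a c\<close>,
  \<open>b c\<close>.\<close>

lemma pendant_triples_family_G:
  fixes G :: "('a, 'b) pre_digraph"
  assumes graph: "graph G" and conn: "Digraph_Component.connected G"
    and P: "adjacency.pendant_triples (arcs_ends G) (verts G) C a b"
  shows "G \<in> family_G"
proof -
  interpret graph G
    by fact
  interpret adjacency "arcs_ends G"
    by (rule adjacency_arcs_ends)
  let ?E = "arcs_ends G"
  define G\<^sub>0 where "G\<^sub>0 = \<lparr>pverts = C, parcs = ?E \<inter> C \<times> C\<rparr>"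
  define A where "A c = (if (c, b c) \<in> ?E then C3 else P3)" for c
  define f where "f = (\<lambda>(c, i::nat). if i = 0 then c else if i = 1 then a c else b c)"
  let ?H = "attach (with_proj G\<^sub>0) A"
  have G\<^sub>0: "pverts G\<^sub>0 = C" "parcs G\<^sub>0 = ?E \<inter> C \<times> C"
    by (simp_all add: G\<^sub>0_def)
  have V: "verts G = C \<union> a ` C \<union> b ` C" and fin: "finite C"
    using P by (simp_all add: pendant_triples_def)
  note nbr = pendant_triples_neighbour[OF P] and in_triple = pendant_triples_edge[OF P]
  have pair_graph: "pair_graph G\<^sub>0"
  proof
    show "finite (pverts G\<^sub>0)" "finite (parcs G\<^sub>0)"
      using fin by (simp_all add: G\<^sub>0)
    show "symmetric (with_proj G\<^sub>0)"
      using sym by (auto simp: symmetric_def G\<^sub>0 sym_def)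
  qed (use irrefl in \<open>auto simp: G\<^sub>0\<close>)
  have connected: "Digraph_Component.connected (with_proj G\<^sub>0)"
  proof -
    have sc: "strongly_connected G"
      using conn symmetric_connected_imp_strongly_connected sym_arcs by blast
    have "(u, v) \<in> rtrancl_on C ((parcs G\<^sub>0)\<^sup>s)" if u: "u \<in> C" and v: "v \<in> C" for u v
    proof -
      have "u \<rightarrow>\<^sup>*\<^bsub>G\<^esub> v"
        using sc u v V by (auto simp: strongly_connected_def)
      \<comment> \<open>Follow the walk in \<open>G\<close> and record the circled vertex of the
        triple being visited. The recorded vertices form a walk in \<open>G\<^sub>0\<close>, with
        repetitions while the walk stays in a triple.\<close>
      then have "\<exists>c\<in>C. (v = c \<or> v = a c \<or> v = b c) \<and> (u, c) \<in> rtrancl_on C ((parcs G\<^sub>0)\<^sup>s)"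
      proof (induction rule: reachable_induct)
        case base
        then show ?case
          using u by auto
      next
        case (step x y)
        then obtain c where c: "c \<in> C" "x = c \<or> x = a c \<or> x = b c"
          "(u, c) \<in> rtrancl_on C ((parcs G\<^sub>0)\<^sup>s)"
          by blast
        have y: "y \<in> verts G"
          using step.hyps(2) adj_in_verts by blast
        consider "x \<noteq> c" | "x = c" "y \<in> C" | c' where "x = c" "c' \<in> C" "y = a c' \<or> y = b c'"
          using y V by blast
        then show ?case
        proof cases
          case 1
          then have "y = c \<or> y = a c \<or> y = b c"
            using c nbr[OF c(1) y] step.hyps(2) by blast
          then show ?thesis
            using c by blast
        next
          case 2
          then have "(c, y) \<in> (parcs G\<^sub>0)\<^sup>s"
            using step.hyps(2) c(1) by (simp add: symcl_def G\<^sub>0)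
          then have "(u, y) \<in> rtrancl_on C ((parcs G\<^sub>0)\<^sup>s)"
            using c(3) 2(2) rtrancl_on_into_rtrancl_on by fast
          then show ?thesis
            using 2(2) by blast
        next
          case 3
          \<comment> \<open>A vertex that is not circled has no circled neighbour except that of its
            own triple.\<close>
          have "(y, c) \<in> ?E"
            using sym step.hyps(2) 3(1) by blast
          then have "c = c'"
            using nbr[OF 3(2) in_triple(3)[OF c(1)]] in_triple(6,7)[OF 3(2)] c(1) 3(3) by blast
          then show ?thesis
            using c 3 by blast
        qed
      qed
      then show ?thesis
        using v in_triple(6,7) by blast
    qed
    moreover have "C \<noteq> {}"
      using sc V by (auto simp: strongly_connected_def)
    ultimately show ?thesis
      by (simp add: connected_conv G\<^sub>0(1))
  qed
  have A: "pverts (A c) = {0, 1, 2}" for c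
    by (simp add: A_def attachable_simps)
  have pvH: "pverts ?H = C \<times> {0, 1, 2}"
    using A by (simp add: attach_def G\<^sub>0)
  have inj: "f p = f q \<Longrightarrow> p = q" if "p \<in> pverts ?H" "q \<in> pverts ?H" for p q
  proof -
    have "inj_on a C" "inj_on b C" "a ` C \<inter> b ` C = {}"
      using P by (simp_all add: pendant_triples_def)
    then have "a c = a c' \<longleftrightarrow> c = c'" "b c = b c' \<longleftrightarrow> c = c'" "a c \<noteq> b c'" "b c' \<noteq> a c"
      "a c \<noteq> c'" "b c \<noteq> c'" "c' \<noteq> a c" "c' \<noteq> b c" if "c \<in> C" "c' \<in> C" for c c'
      using that in_triple(6,7)[OF that(1)] by (auto dest: inj_onD)
    then show "f p = f q \<Longrightarrow> p = q"
      using that unfolding pvH f_def by auto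
  qed
  have iso: "digraph_iso G (with_proj ?H)"
  proof (rule digraph_iso_with_projI)
    show "bij_betw f (pverts ?H) (verts G)"
      unfolding bij_betw_def
    proof
      show "inj_on f (pverts ?H)"
        using inj by (auto intro: inj_onI)
      have "f ` (C \<times> {0, 1, 2}) = (\<lambda>c. f (c, 0)) ` C \<union> (\<lambda>c. f (c, 1)) ` C \<union> (\<lambda>c. f (c, 2)) ` C"
        by blast
      also have "\<dots> = C \<union> a ` C \<union> b ` C"
        by (simp add: f_def)
      finally have "f ` (C \<times> {0, 1, 2}) = C \<union> a ` C \<union> b ` C" .
      then show "f ` pverts ?H = verts G"
        using pvH V by simp
    qed
    show "parcs ?H \<subseteq> pverts ?H \<times> pverts ?H"
    proof
      fix pq assume "pq \<in> parcs ?H"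
      then show "pq \<in> pverts ?H \<times> pverts ?H"
        unfolding pvH by (cases pq) (auto simp: attach_def G\<^sub>0 A_def attachable_simps split: if_splits)
    qed
    fix p q assume "p \<in> pverts ?H" "q \<in> pverts ?H"
    then obtain c i c' j where p: "p = (c, i)" "c \<in> C" "i \<in> {0, 1, 2}"
      and q: "q = (c', j)" "c' \<in> C" "j \<in> {0, 1, 2}"
      unfolding pvH by blast
    show "(p, q) \<in> parcs ?H \<longleftrightarrow> f p \<rightarrow>\<^bsub>G\<^esub> f q"
    proof (cases "c = c'")
      case True
      have "(c, a c) \<in> ?E" "(a c, c) \<in> ?E" "(a c, b c) \<in> ?E" "(b c, a c) \<in> ?E"
        "(b c, c) \<in> ?E \<longleftrightarrow> (c, b c) \<in> ?E"
        using in_triple(1,2)[OF p(2)] sym by blast+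
      then show ?thesis
        using p q True irrefl
        by (auto simp: attach_arc G\<^sub>0 A_def f_def attachable_simps)
    next
      case False
      have fp: "f p \<in> verts G" and fq: "f q \<in> verts G"
        using p q in_triple by (auto simp: f_def)
      \<comment> \<open>Different triples are disjoint. Since \<open>a c\<close> and
        \<open>b c\<close> have no neighbours outside their triple, arcs between different triples
        join circled vertices.\<close>
      have other: "f (c\<^sub>1, k) \<notin> {c\<^sub>2, a c\<^sub>2, b c\<^sub>2}" if "c\<^sub>1 \<in> C" "c\<^sub>2 \<in> C" "c\<^sub>1 \<noteq> c\<^sub>2" "k \<in> {0, 1, 2}" for c\<^sub>1 c\<^sub>2 k
      proof -
        have "{c\<^sub>2, a c\<^sub>2, b c\<^sub>2} = {f (c\<^sub>2, 0), f (c\<^sub>2, 1), f (c\<^sub>2, 2)}"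
          by (simp add: f_def)
        then show ?thesis
          using inj[of "(c\<^sub>1, k)"] that by (auto simp: pvH)
      qed
      have "\<not> f p \<rightarrow>\<^bsub>G\<^esub> f q" if "i \<noteq> 0"
      proof -
        have "f p = a c \<or> f p = b c"
          using that p by (simp add: f_def)
        then show ?thesis
          using nbr[OF p(2) fq] other[OF q(2) p(2) False[symmetric] q(3)] q(1) by auto
      qed
      moreover have "\<not> f p \<rightarrow>\<^bsub>G\<^esub> f q" if "j \<noteq> 0"
      proof -
        have "f q = a c' \<or> f q = b c'"
          using that q by (simp add: f_def)
        then have "\<not> f q \<rightarrow>\<^bsub>G\<^esub> f p"
          using nbr[OF q(2) fp] other[OF p(2) q(2) False p(3)] p(1) by auto
        then show ?thesis
          using sym by blast
      qed
      ultimately show ?thesis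
        using p q False by (auto simp: attach_arc G\<^sub>0 f_def)
    qed
  qed
  have "A c \<in> attachable" for c
    by (simp add: A_def attachable_def)
  then show ?thesis
    unfolding family_G_def using pair_graph connected iso by blast
qed

section \<open>The equality case for block graphs\<close>

theorem theorem14:
  fixes G :: "('a,'b) pre_digraph" and n :: nat
  assumes "block_graph G" and "card (verts G) = n"
  shows "real (isolation_number G) = real n / 3 \<longleftrightarrow> G \<in> family_B"
proof -
  interpret graph G
    using assms(1) by (simp add: block_graph_def)
  interpret adjacency "arcs_ends G"
    by (rule adjacency_arcs_ends)
  have "real (isolation_number G) = real n / 3 \<longleftrightarrow> card (verts G) = 3 * isolation_number G"
    using assms(2) by (auto simp: field_simps)
  also have "\<dots> \<longleftrightarrow> G \<in> family_G"
  proof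
    assume eq: "card (verts G) = 3 * isolation_number G"
    obtain r par d where "sibling_tree (verts G) r par d"
      using block_graph_sibling_tree[OF assms(1)] by blast
    then have "card (verts G) = 2 \<or> small_or_pendant (verts G)"
      by (rule sibling_tree_small_or_pendant)
    \<comment> \<open>Order 2 is excluded because 2 is not divisible by 3.\<close>
    then have "small_or_pendant (verts G)"
      using eq by presburger
    \<comment> \<open>Minimality of the isolation number rules out the first alternative of
      \<open>small_or_pendant\<close>.\<close>
    moreover have "\<not> 3 * card D < card (verts G)" if "isolates (verts G) D" for D
      using isolation_number_le[OF finite_verts] that eq isolating_set_iff_isolates by fastforce
    ultimately obtain C a b where "pendant_triples (verts G) C a b"
      by (auto simp: small_or_pendant_def)
    then show "G \<in> family_G"
      using assms(1) pendant_triples_family_G[of G] by (simp add: block_graph_def)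
  next
    assume "G \<in> family_G"
    then show "card (verts G) = 3 * isolation_number G"
      using wf_digraph by (rule isolation_number_family_G)
  qed
  also have "\<dots> \<longleftrightarrow> G \<in> family_B"
    using assms(1) by (simp add: family_B_def)
  finally show ?thesis .
qed

end
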